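(* Let $X$ be a Polish space, $\mu$ a probability measure on $\varGamma_X^\sharp$, and $\{\eta_x\}_{x\in X}$ a family of probability measures on $\mathfrak{X}$ such that $x\mapsto\eta_x(\bar B)$ is Borel measurable for every Borel set $\bar B\subset\mathfrak{X}$. Let $\mu_{\mathrm{cl}}$ be the corresponding cluster measure on $\varGamma_X^\sharp$ and let $\hat\mu$ be the skew-product measure on $\varGamma_{\mathcal{Z}}^\sharp$. Then $\mu_{\mathrm{cl}}$ coincides with the push-forward of $\hat\mu$ under the map $\mathfrak{q}:\varGamma_{\mathcal{Z}}^\sharp\to\varGamma_X^\sharp$: $$\mu_{\mathrm{cl}}=\mathfrak{q}^*\hat\mu\equiv\hat\mu\circ\mathfrak{q}^{-1}.$$
   Context: For a Polish space $S$, $\varGamma_S^\sharp$ denotes the set of generalised configurations in $S$: measures $\gamma=\sum_i\delta_{s_i}$ for a finite or countably infinite family of points $s_i\in S$ (multiple points and accumulation points are allowed), equipped with the $\sigma$-algebra generated by the sets $\{\gamma:\gamma(B)=n\}$, $B\in\mathcal{B}(S)$, $n\in\{0,1,2,\dots\}$. Sums and products over $s\in\gamma$ take multiplicities into account, and $\langle f,\gamma\rangle:=\sum_{s\in\gamma}f(s)=\int f\,d\gamma$. $\mathfrak{X}:=\bigsqcup_{n\in\{0,1,\dots\}\cup\{\infty\}}X^n$, with $X^0=\{\emptyset\}$ and $X^\infty$ the space of infinite sequences, with the disjoint union topology. For $\bar y=(y_1,y_2,\dots)\in\mathfrak{X}$ put $\mathfrak{p}(\bar y):=\sum_{y_i\in\bar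 y}\delta_{y_i}\in\varGamma_X^\sharp$. Cluster measure: $\mu_{\mathrm{cl}}$ is the distribution on $\varGamma_X^\sharp$ of the random configuration $\gamma=\sum_{x\in\gamma_c}\gamma_x'$, where $\gamma_c$ has distribution $\mu$ and, given $\gamma_c$, the configurations $\gamma_x'$ ($x\in\gamma_c$) are independent with distributions $\eta_x\circ\mathfrak{p}^{-1}$. Equivalently, $\mu_{\mathrm{cl}}$ is the probability measure on $\varGamma_X^\sharp$ with Laplace functional $$\int_{\varGamma_X^\sharp} e^{-\langle f,\gamma\rangle}\mu_{\mathrm{cl}}(d\gamma)=\int_{\varGamma_X^\sharp}\prod_{x\in\gamma}\Bigl(\int_{\mathfrak{X}}\exp\bigl(-\textstyle\sum_{y_i\in\bar y}f(y_i)\bigr)\eta_x(d\bar y)\Bigr)\mu(d\gamma)$$ for all measurable $f:X\to[0,\infty)$. Skew product: $\mathcal{Z}:=X\times\mathfrak{X}$. For $\gamma\in\varGamma_X^\sharp$ let $\eta^\gamma:=\bigotimes_{x\in\gamma}\eta_x$ on $\mathfrak{X}^\gamma=\prod_{x\in\gamma}\mathfrak{X}$; a pair $(\gamma,\bar y^\gamma)$ with $\bar y^\gamma=(\bar y_x)_{x\in\gamma}\in\mathfrak{X}^\gamma$ is identified with $\hat\gamma=\sum_{x\in\gamma}\delta_{(x,\bar y_x)}\in\varGamma_{\mathcal{Z}}^\sharp$. The probability measure $\hat\mu$ on $\varGamma_{\mathcal{Z}}^\sharp$ is defined by $\int F\,d\hat\mu=\int_{\varGamma_X^\sharp}\bigl(\int_{\mathfrak{X}^\gamma}F(\gamma,\bar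 y^\gamma)\,\eta^\gamma(d\bar y^\gamma)\bigr)\mu(d\gamma)$ for measurable $F\ge0$. The map $\mathfrak{q}$: $\mathfrak{q}(\hat\gamma):=\sum_{(x,\bar y)\in\hat\gamma}\mathfrak{p}(\bar y)$. *)

theory Defs
  imports "HOL-Probability.Probability"
begin

text \<open>Polish spaces are abstract topologies here (not the type class \<open>polish_space\<close>), so that
  \<open>X\<close>, the disjoint union of its powers, and the product of the two are treated by the same
  definitions.\<close>

definition borel_of :: "'a topology \<Rightarrow> 'a measure"
  where "borel_of S = sigma (topspace S) {U. openin S U}"

text \<open>The measure \<open>\<Sum>i\<in>I. \<delta>(s i)\<close>, expressed as the image of counting measure on the index set;
  it assigns to \<open>B\<close> the number of indices \<open>i\<close> with \<open>s i \<in> B\<close> (see the lemma below).\<close>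

definition dirac_sum :: "'a topology \<Rightarrow> 'i set \<Rightarrow> ('i \<Rightarrow> 'a) \<Rightarrow> 'a measure"
  where "dirac_sum S I s = distr (count_space I) (borel_of S) s"

lemma emeasure_dirac_sum:
  assumes "s \<in> I \<rightarrow> topspace S" "B \<in> sets (borel_of S)"
  shows "emeasure (dirac_sum S I s) B = (\<integral>\<^sup>+i. emeasure (return (borel_of S) (s i)) B \<partial>count_space I)"
proof -
  have sp: "space (borel_of S) = topspace S"
    by (simp add: borel_of_def space_measure_of_conv)
  have m: "s \<in> measurable (count_space I) (borel_of S)"
    using assms(1) by (simp add: sp)
  have "emeasure (dirac_sum S I s) B = emeasure (count_space I) (s -` B \<inter> I)"
    unfolding dirac_sum_def using m assms(2) by (subst emeasure_distr) auto
  also have "\<dots> = (\<integral>\<^sup>+i. indicator (s -` B \<inter> I) i \<partial>count_space I)"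
    by (subst nn_integral_indicator) auto
  also have "\<dots> = (\<integral>\<^sup>+i. emeasure (return (borel_of S) (s i)) B \<partial>count_space I)"
    using assms by (intro nn_integral_cong) (auto split: split_indicator)
  finally show ?thesis .
qed

text \<open>Generalised configurations: sums of Dirac measures over finite or countably infinite families.
  A subset of \<open>nat\<close> serves as the index set of the family.\<close>

definition configs :: "'a topology \<Rightarrow> 'a measure set"
  where "configs S = {dirac_sum S I s | (I :: nat set) s. s \<in> I \<rightarrow> topspace S}"

definition config_space :: "'a topology \<Rightarrow> 'a measure measure"
  where "config_space S = sigma (configs S)
    {{\<gamma> \<in> configs S. emeasure \<gamma> B = of_nat n} | B (n::nat). B \<in> sets (borel_of S)}"

text \<open>The points of \<open>\<gamma>\<close> listed with multiplicity: \<open>x\<close> occurs as \<open>(x, 0), (x, 1), \<dots>\<close>, with exactly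
  \<open>\<gamma> {x}\<close> (possibly infinitely many) copies. This set indexes the products over \<open>x \<in> \<gamma>\<close>.\<close>

definition config_index :: "'a measure \<Rightarrow> ('a \<times> nat) set"
  where "config_index \<gamma> = {(x, k). of_nat k < emeasure \<gamma> {x}}"

definition config_pairing :: "('a \<Rightarrow> real) \<Rightarrow> 'a measure \<Rightarrow> ennreal"
  where "config_pairing f \<gamma> = (\<integral>\<^sup>+x. ennreal (f x) \<partial>\<gamma>)"

text \<open>Unordered product over \<open>x \<in> \<gamma>\<close>, the limit of the net of finite partial products. It is only
  used for factors in \<open>[0, 1]\<close>, where the limit exists; it may well be \<open>0\<close>, which is why
  \<open>prodinf\<close> is not suitable.\<close>

definition config_prod :: "'a measure \<Rightarrow> ('a \<Rightarrow> ennreal) \<Rightarrow> ennreal"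
  where "config_prod \<gamma> g = Lim (finite_subsets_at_top (config_index \<gamma>)) (\<lambda>F. \<Prod>(x, k)\<in>F. g x)"

text \<open>\<open>exp (- t)\<close> for \<open>t \<in> [0, \<infinity>]\<close>, with \<open>exp (- \<infinity>) = 0\<close>.\<close>

definition exp_minus :: "ennreal \<Rightarrow> ennreal"
  where "exp_minus t = (if t = \<infinity> then 0 else ennreal (exp (- enn2real t)))"

text \<open>The disjoint union of \<open>X^n\<close> over \<open>n \<in> {0, 1, \<dots>} \<union> {\<infinity>}\<close>. An element is a pair of its
  length \<open>n\<close> and a function on \<open>{i. i < n}\<close>, extended by \<open>undefined\<close>; indexing starts at \<open>0\<close>.\<close>

type_synonym 'a cluster = "enat \<times> (nat \<Rightarrow> 'a)"

definition cluster_ix :: "'a cluster \<Rightarrow> nat set"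
  where "cluster_ix y = {i. enat i < fst y}"

definition cluster_topology :: "'a topology \<Rightarrow> 'a cluster topology"
  where "cluster_topology X = sum_topology (\<lambda>n. product_topology (\<lambda>_. X) {i. enat i < n}) UNIV"

text \<open>The map \<open>\<pp>\<close>.\<close>

definition cluster_config :: "'a topology \<Rightarrow> 'a cluster \<Rightarrow> 'a measure"
  where "cluster_config X y = dirac_sum X (cluster_ix y) (snd y)"

text \<open>The cluster measure is the probability measure on configurations determined by its Laplace
  functional.\<close>

definition is_cluster_measure ::
    "'a topology \<Rightarrow> ('a \<Rightarrow> 'a cluster measure) \<Rightarrow> 'a measure measure \<Rightarrow> 'a measure measure \<Rightarrow> bool"
  where "is_cluster_measure X \<eta> \<mu> \<nu> \<longleftrightarrow>
    prob_space \<nu> \<and> sets \<nu> = sets (config_space X) \<and>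
    (\<forall>f \<in> borel_measurable (borel_of X). (\<forall>x\<in>topspace X. 0 \<le> f x) \<longrightarrow>
      (\<integral>\<^sup>+\<gamma>. exp_minus (config_pairing f \<gamma>) \<partial>\<nu>) =
      (\<integral>\<^sup>+\<gamma>. config_prod \<gamma>
        (\<lambda>x. \<integral>\<^sup>+y. exp_minus (\<Sum>\<^sub>\<infinity>i\<in>cluster_ix y. ennreal (f (snd y i))) \<partial>\<eta> x) \<partial>\<mu>))"

definition cluster_measure ::
    "'a topology \<Rightarrow> ('a \<Rightarrow> 'a cluster measure) \<Rightarrow> 'a measure measure \<Rightarrow> 'a measure measure"
  where "cluster_measure X \<eta> \<mu> = (THE \<nu>. is_cluster_measure X \<eta> \<mu> \<nu>)"

definition skew_topology :: "'a topology \<Rightarrow> ('a \<times> 'a cluster) topology"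
  where "skew_topology X = prod_topology X (cluster_topology X)"

definition cluster_product ::
    "('a \<Rightarrow> 'a cluster measure) \<Rightarrow> 'a measure \<Rightarrow> ('a \<times> nat \<Rightarrow> 'a cluster) measure"
  where "cluster_product \<eta> \<gamma> = PiM (config_index \<gamma>) (\<lambda>(x, k). \<eta> x)"

text \<open>The identification of a configuration with a cluster attached to each of its points, as a
  configuration in \<open>X \<times> \<XX>\<close>.\<close>

definition marked_config ::
    "'a topology \<Rightarrow> 'a measure \<Rightarrow> ('a \<times> nat \<Rightarrow> 'a cluster) \<Rightarrow> ('a \<times> 'a cluster) measure"
  where "marked_config X \<gamma> y = dirac_sum (skew_topology X) (config_index \<gamma>) (\<lambda>(x, k). (x, y (x, k)))"

definition is_skew_measure ::
    "'a topology \<Rightarrow> ('a \<Rightarrow> 'a cluster measure) \<Rightarrow> 'a measure measure \<Rightarrow>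
      ('a \<times> 'a cluster) measure measure \<Rightarrow> bool"
  where "is_skew_measure X \<eta> \<mu> \<nu> \<longleftrightarrow>
    prob_space \<nu> \<and> sets \<nu> = sets (config_space (skew_topology X)) \<and>
    (\<forall>F :: _ \<Rightarrow> ennreal. F \<in> borel_measurable (config_space (skew_topology X)) \<longrightarrow>
      (\<integral>\<^sup>+\<zeta>. F \<zeta> \<partial>\<nu>) = (\<integral>\<^sup>+\<gamma>. (\<integral>\<^sup>+y. F (marked_config X \<gamma> y) \<partial>cluster_product \<eta> \<gamma>) \<partial>\<mu>))"

definition skew_measure ::
    "'a topology \<Rightarrow> ('a \<Rightarrow> 'a cluster measure) \<Rightarrow> 'a measure measure \<Rightarrow>
      ('a \<times> 'a cluster) measure measure"
  where "skew_measure X \<eta> \<mu> = (THE \<nu>. is_skew_measure X \<eta> \<mu> \<nu>)"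

text \<open>The map \<open>\<qq>\<close>. The sum over \<open>(x, y) \<in> \<zeta>\<close>, with multiplicities, is the integral with respect
  to \<open>\<zeta>\<close>, evaluated setwise.\<close>

definition cluster_union :: "'a topology \<Rightarrow> ('a \<times> 'a cluster) measure \<Rightarrow> 'a measure"
  where "cluster_union X \<zeta> = measure_of (topspace X) (sets (borel_of X))
    (\<lambda>B. \<integral>\<^sup>+(x, y). emeasure (cluster_config X y) B \<partial>\<zeta>)"

end

theory Submission
  imports Defs
begin

text \<open>
  A probability measure on configurations is determined by its Laplace functional, and the same
  argument shows that a family of such measures is a measurable kernel as soon as all its Laplace
  transforms are measurable. For a configuration \<open>\<gamma>\<close> with independent marks
  \<open>y\<^sub>x \<sim> \<eta>\<^sub>x\<close>, the Laplace transform at \<open>g\<close> is the product over \<open>x \<in> \<gamma>\<close> of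
  \<open>\<integral>exp (- g (x, y)) \<eta>\<^sub>x(dy)\<close>. Writing each factor as \<open>exp (- h x)\<close> with \<open>h x \<in> [0, \<infinity>]\<close> turns the
  product into \<open>exp (- \<integral>h d\<gamma>)\<close>, which is measurable in \<open>\<gamma>\<close>; no measurable enumeration of the points
  of \<open>\<gamma>\<close> is needed. Hence the skew-product measure exists, and the choice
  \<open>g (x, y) = \<Sum>\<^sub>i f (y\<^sub>i)\<close> identifies the Laplace functional of its image under \<open>\<qq>\<close> with that of the
  cluster measure.
\<close>

section \<open>Borel sets of topologies\<close>

text \<open>Both \<open>cluster_measure\<close> and \<open>skew_measure\<close> are definite
  descriptions, so the equation has content only once each is shown to denote. The image of the skew
  measure under \<open>cluster_union\<close> serves as the existence witness for the cluster
  measure; together with uniqueness this already is the theorem. The main obstacle is that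
  \<open>cluster_product \<eta> \<gamma>\<close> lives on a product space whose index set changes
  with \<open>\<gamma>\<close>, so Fubini gives no measurability in \<open>\<gamma>\<close>. Pushing
  these laws into one configuration space gives them a common target, but its generating events
  (exactly n points in B) are in general not stable under intersection, and their probabilities
  under independent marks have no convenient form. Laplace transforms meet both difficulties: they
  are multiplicative in the test function and explicit for independent marks. Accumulation points
  are allowed, so exponents may be infinite and products may vanish; all identities are therefore
  stated on [0, \<infinity>] with exp(-\<infinity>) = 0.\<close>

lemma space_borel_of [simp]: "space (borel_of S) = topspace S"
  by (simp add: borel_of_def space_measure_of_conv)

lemma sets_borel_of: "sets (borel_of S) = sigma_sets (topspace S) {U. openin S U}"
  unfolding borel_of_def by (rule sets_measure_of) (auto dest: openin_subset)

lemma openin_in_borel_of: "openin S U \<Longrightarrow> U \<in> sets (borel_of S)"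
  by (simp add: sets_borel_of sigma_sets.Basic)

lemma closedin_in_borel_of:
  assumes "closedin S C"
  shows "C \<in> sets (borel_of S)"
proof -
  have "topspace S - (topspace S - C) \<in> sets (borel_of S)"
    using assms by (metis closedin_def openin_in_borel_of sets.compl_sets space_borel_of)
  then show ?thesis
    using assms by (simp add: closedin_def double_diff)
qed

lemma continuous_map_borel_measurable:
  assumes "continuous_map S T f"
  shows "f \<in> measurable (borel_of S) (borel_of T)"
  unfolding borel_of_def [of T]
proof (rule measurable_measure_of)
  show "f \<in> space (borel_of S) \<rightarrow> topspace T"
    using assms by (auto simp: continuous_map_def)
  fix U assume "U \<in> {U. openin T U}"
  then have "openin S {x \<in> topspace S. f x \<in> U}"
    using assms by (auto simp: continuous_map_def)
  moreover have "f -` U \<inter> topspace S = {x \<in> topspace S. f x \<in> U}"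
    by auto
  ultimately show "f -` U \<inter> space (borel_of S) \<in> sets (borel_of S)"
    by (simp add: openin_in_borel_of)
qed (auto dest: openin_subset)

section \<open>Second countability and Borel sets of products\<close>

lemma completely_metrizable_separable_imp_second_countable:
  assumes "completely_metrizable_space X" "separable_space X"
  shows "second_countable X"
proof -
  obtain M d where "Metric_space M d" and X: "X = Metric_space.mtopology M d"
    using assms(1) unfolding completely_metrizable_space_def Metric_space.mcomplete_def by auto
  then interpret Metric_space M d by simp
  obtain D where D: "countable D" "D \<subseteq> M" "mtopology closure_of D = M"
    using assms(2) by (auto simp: separable_space_def X)
  let ?B = "(\<lambda>(x, n). mball x (inverse (real (Suc n)))) ` (D \<times> UNIV)"
  have "\<exists>V\<in>?B. x \<in> V \<and> V \<subseteq> U" if "openin X U" "x \<in> U" for x U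
  proof -
    obtain r where r: "r > 0" "mball x r \<subseteq> U" and x: "x \<in> M"
      using \<open>openin X U\<close> \<open>x \<in> U\<close> unfolding X openin_mtopology by blast
    \<comment> \<open>Half of r, because the basic ball is centred at a nearby point z of
      \<open>D\<close> instead of x: two distances below 1/(n+1) must add up to less than r.\<close>
    obtain n where n: "inverse (real (Suc n)) < r / 2"
      using r(1) reals_Archimedean [of "r / 2"] by auto
    have "openin mtopology (mball x (inverse (real (Suc n))))" "x \<in> mball x (inverse (real (Suc n)))"
      using x by auto
    moreover have "x \<in> mtopology closure_of D" using x D(3) by simp
    ultimately obtain z where z: "z \<in> D" "z \<in> mball x (inverse (real (Suc n)))"
      unfolding in_closure_of by blast
    have zM: "z \<in> M" using z D by auto
    have "x \<in> mball z (inverse (real (Suc n)))"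
      using z x by (auto simp: commute)
    moreover have "mball z (inverse (real (Suc n))) \<subseteq> U"
    proof -
      have "y \<in> mball x r" if "y \<in> mball z (inverse (real (Suc n)))" for y
        using that z x zM n triangle [of x z y] by auto
      then show ?thesis using r by blast
    qed
    ultimately show ?thesis
      using z by (intro bexI [of _ "mball z (inverse (real (Suc n)))"]) auto
  qed
  then show ?thesis
    unfolding second_countable_def using D by (intro exI [of _ ?B]) (auto simp: X)
qed

text \<open>A countable base of one factor suffices: for each basic V take the largest open set
  \<open>W V\<close> with V \<times> W(V) inside U; these countably many rectangles cover U. The
  second factor may thus be the cluster topology without any study of its base.\<close>

lemma sets_borel_of_prod_le:
  assumes "second_countable X"
  shows "sets (borel_of (prod_topology X Y)) \<subseteq> sets (borel_of X \<Otimes>\<^sub>M borel_of Y)"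
proof -
  obtain \<B> where \<B>: "countable \<B>" "\<And>V. V \<in> \<B> \<Longrightarrow> openin X V"
    "\<And>U x. openin X U \<Longrightarrow> x \<in> U \<Longrightarrow> \<exists>V\<in>\<B>. x \<in> V \<and> V \<subseteq> U"
    using assms by (auto simp: second_countable_def)
  have sp: "topspace (prod_topology X Y) = space (borel_of X \<Otimes>\<^sub>M borel_of Y)"
    by (simp add: space_pair_measure)
  have "U \<in> sets (borel_of X \<Otimes>\<^sub>M borel_of Y)" if U: "openin (prod_topology X Y) U" for U
  proof -
    define W where "W V = \<Union>{B. openin Y B \<and> V \<times> B \<subseteq> U}" for V
    have W: "openin Y (W V)" for V
      unfolding W_def by (intro openin_Union) auto
    have "U = (\<Union>V\<in>\<B>. V \<times> W V)"
    proof (intro subset_antisym subrelI)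
      fix x y assume "(x, y) \<in> U"
      then obtain A B where AB: "openin X A" "openin Y B" "x \<in> A" "y \<in> B" "A \<times> B \<subseteq> U"
        using U unfolding openin_prod_topology_alt by meson
      then obtain V where V: "V \<in> \<B>" "x \<in> V" "V \<subseteq> A" using \<B>(3) by meson
      then have "y \<in> W V" using AB unfolding W_def by blast
      then show "(x, y) \<in> (\<Union>V\<in>\<B>. V \<times> W V)" using V by auto
    qed (auto simp: W_def)
    also have "\<dots> \<in> sets (borel_of X \<Otimes>\<^sub>M borel_of Y)"
      using \<B>(1,2) W by (auto intro!: sets.countable_UN' pair_measureI openin_in_borel_of)
    finally show ?thesis .
  qed
  then show ?thesis
    unfolding sets_borel_of sp by (intro sets.sigma_sets_subset) auto
qed

lemma measurable_borel_of_prod: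
  assumes "second_countable X" "f \<in> measurable (borel_of (prod_topology X Y)) N"
  shows "f \<in> measurable (borel_of X \<Otimes>\<^sub>M borel_of Y) N"
  using measurable_mono [of N N "borel_of (prod_topology X Y)" "borel_of X \<Otimes>\<^sub>M borel_of Y"]
    sets_borel_of_prod_le [OF assms(1), of Y] assms(2)
  by (auto simp: space_pair_measure)

section \<open>Infinite products as exponentials\<close>

lemma exp_minus_0 [simp]: "exp_minus 0 = 1"
  by (simp add: exp_minus_def)

lemma exp_minus_ennreal: "0 \<le> x \<Longrightarrow> exp_minus (ennreal x) = ennreal (exp (- x))"
  by (simp add: exp_minus_def)

lemma exp_minus_le_1: "exp_minus t \<le> 1"
  by (auto simp: exp_minus_def ennreal_le_1)

lemma exp_minus_add: "exp_minus (s + t) = exp_minus s * exp_minus t"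
  by (cases s; cases t) (auto simp: exp_minus_def ennreal_mult [symmetric] exp_add [symmetric] ennreal_plus[symmetric]
        simp del: ennreal_plus)

lemma exp_minus_sum: "exp_minus (\<Sum>i\<in>F. h i) = (\<Prod>i\<in>F. exp_minus (h i))"
  by (induction F rule: infinite_finite_induct) (auto simp: exp_minus_add)

lemma exp_minus_eq_iff: "exp_minus s = exp_minus t \<longleftrightarrow> s = t"
  by (cases s; cases t) (auto simp: exp_minus_def)

lemma tendsto_exp_minus:
  assumes "(f \<longlongrightarrow> t) F"
  shows "((\<lambda>x. exp_minus (f x)) \<longlongrightarrow> exp_minus t) F"
proof (cases t)
  case (real r)
  have "eventually (\<lambda>x. f x < \<infinity>) F"
    using order_tendstoD(2) [OF assms, of \<infinity>] real by simp
  then have ev: "eventually (\<lambda>x. ennreal (exp (- enn2real (f x))) = exp_minus (f x)) F"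
    by eventually_elim (auto simp: exp_minus_def)
  have "((\<lambda>x. enn2real (f x)) \<longlongrightarrow> r) F"
    using tendsto_enn2real [of f r F] assms real by simp
  then have "((\<lambda>x. ennreal (exp (- enn2real (f x)))) \<longlongrightarrow> ennreal (exp (- r))) F"
    by (intro tendsto_ennrealI tendsto_exp tendsto_minus)
  then show ?thesis
    using real tendsto_cong [OF ev] by (simp add: exp_minus_ennreal)
next
  case top
  show ?thesis
  proof (rule order_tendstoI)
    fix a assume "exp_minus t < a"
    then have "0 < a" by (simp add: exp_minus_def top)
    then obtain e where e: "0 < ennreal e" "ennreal e < a" "0 < e"
      by (metis ennreal_cases dense ennreal_less_zero_iff not_less_iff_gr_or_eq top.not_eq_extremum ennreal_less_top)
    \<comment> \<open>The threshold solves exp(-s) \<le> e for s. The absolute value covers e > 1,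
      where -ln e is negative and \<open>ennreal\<close> would truncate it.\<close>
    have "eventually (\<lambda>x. ennreal \<bar>ln e\<bar> < f x) F"
      using order_tendstoD(1) [OF assms] top by simp
    then show "eventually (\<lambda>x. exp_minus (f x) < a) F"
    proof eventually_elim
      case (elim x)
      show ?case
      proof (cases "f x")
        case (real s)
        then have "- ln e < s" using elim by (simp add: ennreal_less_iff)
        then have "exp (- s) \<le> e"
          using e(3) by (metis exp_ln exp_less_mono less_eq_real_def minus_less_iff)
        then have "exp_minus (f x) \<le> ennreal e"
          using real by (simp add: exp_minus_ennreal ennreal_leI)
        then show ?thesis using e by simp
      qed (use \<open>0 < a\<close> in \<open>auto simp: exp_minus_def\<close>)
    qed
  qed (auto simp: exp_minus_def top)
qed

lemma measurable_exp_minus [measurable]: "exp_minus \<in> borel_measurable borel"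
  unfolding exp_minus_def by measurable

text \<open>Inverse of \<open>exp_minus\<close> on [0, 1]. The value \<infinity> at 0 is what allows
  vanishing factors in a product.\<close>

definition minus_log :: "ennreal \<Rightarrow> ennreal"
  where "minus_log p = (if p = 0 then \<infinity> else ennreal (- ln (enn2real p)))"

lemma measurable_minus_log [measurable]: "minus_log \<in> borel_measurable borel"
  unfolding minus_log_def by measurable

lemma exp_minus_minus_log: "p \<le> 1 \<Longrightarrow> exp_minus (minus_log p) = p"
  by (cases p) (auto simp: minus_log_def exp_minus_ennreal ennreal_le_1 exp_minus_def top_unique)

text \<open>Unordered sums and products are limits of nets, whereas monotone and dominated
  convergence are about sequences. A sequence of finite sets that is cofinal in the net passes
  between the two.\<close>

lemma countable_exhaustion:
  assumes "countable I"
  shows "\<exists>G :: nat \<Rightarrow> 'i set. incseq G \<and> (\<forall>n. finite (G n) \<and> G n \<subseteq> I) \<and>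
    filterlim G (finite_subsets_at_top I) sequentially"
proof -
  define G where "G n = {i \<in> I. to_nat_on I i < n}" for n :: nat
  have "incseq G" and sub: "G n \<subseteq> I" for n by (auto simp: G_def incseq_def)
  have fin: "finite (G n)" for n
    using finite_vimage_IntI [of "{..<n}" "to_nat_on I" I] assms
    by (auto simp: G_def vimage_def Int_def inj_on_to_nat_on elim: finite_subset [rotated])
  have "filterlim G (finite_subsets_at_top I) sequentially"
    unfolding filterlim_finite_subsets_at_top
  proof safe
    fix F assume F: "finite F" "F \<subseteq> I"
    obtain m where "\<forall>i\<in>F. to_nat_on I i < m"
      using finite_nat_set_iff_bounded F(1) by (metis finite_imageI imageI)
    then have "F \<subseteq> G n" if "m \<le> n" for n
      using that F by (fastforce simp: G_def)
    then show "eventually (\<lambda>n. finite (G n) \<and> F \<subseteq> G n \<and> G n \<subseteq> I) sequentially"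
      using fin by (intro eventually_sequentiallyI [of m]) (auto simp: G_def)
  qed
  then show ?thesis using \<open>incseq G\<close> fin sub by blast
qed

lemma tendsto_sum_nn_integral_count_space:
  fixes f :: "'i \<Rightarrow> ennreal"
  assumes "countable I"
  shows "((\<lambda>F. \<Sum>i\<in>F. f i) \<longlongrightarrow> (\<integral>\<^sup>+i. f i \<partial>count_space I)) (finite_subsets_at_top I)"
proof (rule order_tendstoI)
  have fin: "(\<Sum>i\<in>F. f i) = (\<integral>\<^sup>+i. f i * indicator F i \<partial>count_space I)" if "finite F" "F \<subseteq> I" for F
    using that by (subst nn_integral_count_space' [of F]) (auto intro!: sum.cong)
  fix a
  { assume "(\<integral>\<^sup>+i. f i \<partial>count_space I) < a"
    then have "(\<Sum>i\<in>F. f i) < a" if "finite F" "F \<subseteq> I" for F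
      unfolding fin [OF that]
      by (rule le_less_trans [rotated]) (auto intro!: nn_integral_mono simp: indicator_def)
    then show "eventually (\<lambda>F. (\<Sum>i\<in>F. f i) < a) (finite_subsets_at_top I)"
      by (intro eventually_finite_subsets_at_top_weakI) auto }
  \<comment> \<open>Monotone convergence along the exhaustion yields one finite \<open>G n\<close>
    whose sum already exceeds a. Terms are nonnegative, so every larger finite set exceeds it
    too.\<close>
  { assume a: "a < (\<integral>\<^sup>+i. f i \<partial>count_space I)"
    obtain G where "incseq G \<and> (\<forall>n. finite (G n) \<and> G n \<subseteq> I) \<and> filterlim G (finite_subsets_at_top I) sequentially"
      using countable_exhaustion [OF assms] ..
    then have inc: "incseq G" and G: "finite (G n)" "G n \<subseteq> I"
      and lim: "filterlim G (finite_subsets_at_top I) sequentially" for n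
      by simp_all
    have "(SUP n. f i * indicator (G n) i) = f i" if "i \<in> I" for i
    proof (rule antisym)
      have "eventually (\<lambda>n. finite (G n) \<and> {i} \<subseteq> G n \<and> G n \<subseteq> I) sequentially"
        using lim that unfolding filterlim_finite_subsets_at_top by blast
      then obtain n where "i \<in> G n"
        unfolding eventually_sequentially by (metis insert_subset order_refl)
      then have "f i * indicator (G n) i = f i" by simp
      then show "f i \<le> (SUP n. f i * indicator (G n) i)" by (metis SUP_upper UNIV_I)
    qed (auto intro!: SUP_least simp: indicator_def)
    then have "(\<integral>\<^sup>+i. f i \<partial>count_space I) = (\<integral>\<^sup>+i. (SUP n. f i * indicator (G n) i) \<partial>count_space I)"
      by (intro nn_integral_cong) auto
    also have "\<dots> = (SUP n. \<integral>\<^sup>+i. f i * indicator (G n) i \<partial>count_space I)"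
      by (intro nn_integral_monotone_convergence_SUP)
        (use inc in \<open>auto simp: incseq_def le_fun_def indicator_def\<close>)
    finally obtain n where "a < (\<integral>\<^sup>+i. f i * indicator (G n) i \<partial>count_space I)"
      using a by (auto simp: less_SUP_iff)
    then have n: "a < (\<Sum>i\<in>G n. f i)" by (simp add: fin G)
    have "a < (\<Sum>i\<in>F. f i)" if "finite F" "G n \<subseteq> F" "F \<subseteq> I" for F
      using n that by (meson less_le_trans sum_mono2 zero_le)
    then show "eventually (\<lambda>F. a < (\<Sum>i\<in>F. f i)) (finite_subsets_at_top I)"
      using G unfolding eventually_finite_subsets_at_top by (intro exI [of _ "G n"]) auto }
qed

lemma borel_measurable_nn_integral_count_space:
  fixes f :: "'i \<Rightarrow> 'b \<Rightarrow> ennreal"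
  assumes "countable I" "\<And>i. i \<in> I \<Longrightarrow> f i \<in> borel_measurable M"
  shows "(\<lambda>y. \<integral>\<^sup>+i. f i y \<partial>count_space I) \<in> borel_measurable M"
proof -
  obtain G where "incseq G \<and> (\<forall>n. finite (G n) \<and> G n \<subseteq> I) \<and> filterlim G (finite_subsets_at_top I) sequentially"
    using countable_exhaustion [OF assms(1)] ..
  then have G: "G n \<subseteq> I" and lim: "filterlim G (finite_subsets_at_top I) sequentially" for n
    by simp_all
  show ?thesis
  proof (rule borel_measurable_LIMSEQ_order)
    show "(\<lambda>n. \<Sum>i\<in>G n. f i y) \<longlonglongrightarrow> (\<integral>\<^sup>+i. f i y \<partial>count_space I)" for y
      using filterlim_compose [OF tendsto_sum_nn_integral_count_space [OF assms(1)] lim] .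
    show "(\<lambda>y. \<Sum>i\<in>G n. f i y) \<in> borel_measurable M" for n
      using G assms(2) by (intro borel_measurable_sum) auto
  qed
qed

lemma infsum_eq_nn_integral_count_space:
  fixes f :: "'i \<Rightarrow> ennreal"
  assumes "countable I"
  shows "(\<Sum>\<^sub>\<infinity>i\<in>I. f i) = (\<integral>\<^sup>+i. f i \<partial>count_space I)"
  using tendsto_sum_nn_integral_count_space [OF assms, of f] by (auto intro!: infsumI simp: has_sum_def)

lemma tendsto_prod_exp_minus:
  assumes "countable I"
  shows "((\<lambda>F. \<Prod>i\<in>F. exp_minus (h i)) \<longlongrightarrow> exp_minus (\<integral>\<^sup>+i. h i \<partial>count_space I)) (finite_subsets_at_top I)"
  using tendsto_exp_minus [OF tendsto_sum_nn_integral_count_space [OF assms, of h]]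
  by (simp add: exp_minus_sum)

text \<open>Only finitely many coordinates enter the partial products, and these converge along an
  exhaustion of \<open>I\<close> by finite sets.\<close>

lemma nn_integral_PiM_exp_minus:
  fixes g :: "'i \<Rightarrow> 'b \<Rightarrow> ennreal"
  assumes I: "countable I" and M: "\<And>i. i \<in> I \<Longrightarrow> prob_space (M i)"
    and g: "\<And>i. i \<in> I \<Longrightarrow> g i \<in> borel_measurable (M i)"
    and h: "\<And>i. i \<in> I \<Longrightarrow> exp_minus (h i) = (\<integral>\<^sup>+y. exp_minus (g i y) \<partial>M i)"
  shows "(\<integral>\<^sup>+y. exp_minus (\<integral>\<^sup>+i. g i (y i) \<partial>count_space I) \<partial>PiM I M) = exp_minus (\<integral>\<^sup>+i. h i \<partial>count_space I)"
proof -
  \<comment> \<open>The locale \<open>product_prob_space\<close> asks for a probability measure at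
    every index, so a Dirac measure fills the indices outside \<open>I\<close>.\<close>
  define N where "N i = (if i \<in> I then M i else return (count_space UNIV) undefined)" for i
  have N: "prob_space (N i)" for i
    using M by (auto simp: N_def intro!: prob_space_return)
  interpret product_prob_space N I
    by (simp add: product_prob_space_def product_prob_space_axioms_def product_sigma_finite_def
        N prob_space_imp_sigma_finite)
  have PiM_eq: "PiM I M = PiM I N" by (rule PiM_cong) (auto simp: N_def)
  have gN: "g i \<in> borel_measurable (N i)" if "i \<in> I" for i
    using g that by (simp add: N_def)
  obtain G where "incseq G \<and> (\<forall>n. finite (G n) \<and> G n \<subseteq> I) \<and> filterlim G (finite_subsets_at_top I) sequentially"
    using countable_exhaustion [OF I] ..
  then have G: "finite (G n)" "G n \<subseteq> I"
    and lim: "filterlim G (finite_subsets_at_top I) sequentially" for n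
    by simp_all
  have lim1: "(\<lambda>n. \<Prod>i\<in>G n. exp_minus (u i)) \<longlonglongrightarrow> exp_minus (\<integral>\<^sup>+i. u i \<partial>count_space I)" for u
    using filterlim_compose [OF tendsto_prod_exp_minus [OF I] lim] .
  have comp: "(\<integral>\<^sup>+y. (\<Prod>i\<in>G n. exp_minus (g i (y i))) \<partial>PiM I N) = (\<Prod>i\<in>G n. exp_minus (h i))" for n
  proof -
    have [measurable]: "(\<lambda>y. \<Prod>i\<in>G n. exp_minus (g i (y i))) \<in> borel_measurable (PiM (G n) N)"
      using G gN by (intro borel_measurable_prod_ennreal measurable_compose [OF _ measurable_exp_minus]
          measurable_compose [OF measurable_component_singleton]) auto
    have "(\<Prod>i\<in>G n. exp_minus (h i)) = (\<Prod>i\<in>G n. \<integral>\<^sup>+y. exp_minus (g i y) \<partial>N i)"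
      using G h by (intro prod.cong) (auto simp: N_def)
    also have "\<dots> = (\<integral>\<^sup>+y. (\<Prod>i\<in>G n. exp_minus (g i (y i))) \<partial>PiM (G n) N)"
      using G gN by (intro product_nn_integral_prod [symmetric] measurable_compose [OF _ measurable_exp_minus]) auto
    also have "\<dots> = (\<integral>\<^sup>+y. (\<Prod>i\<in>G n. exp_minus (g i (y i))) \<partial>distr (PiM I N) (PiM (G n) N) (\<lambda>y. restrict y (G n)))"
      using G by (subst distr_PiM_restrict_finite) auto
    also have "\<dots> = (\<integral>\<^sup>+y. (\<Prod>i\<in>G n. exp_minus (g i (restrict y (G n) i))) \<partial>PiM I N)"
      using G by (subst nn_integral_distr) (auto intro!: measurable_restrict_subset)
    also have "\<dots> = (\<integral>\<^sup>+y. (\<Prod>i\<in>G n. exp_minus (g i (y i))) \<partial>PiM I N)"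
      by (intro nn_integral_cong prod.cong) auto
    finally show ?thesis by simp
  qed
  have meas: "(\<lambda>y. \<Prod>i\<in>G n. exp_minus (g i (y i))) \<in> borel_measurable (PiM I N)" for n
    using G gN by (intro borel_measurable_prod_ennreal measurable_compose [OF _ measurable_exp_minus]
        measurable_compose [OF measurable_component_singleton]) auto
  have "(\<lambda>n. \<integral>\<^sup>+y. (\<Prod>i\<in>G n. exp_minus (g i (y i))) \<partial>PiM I N)
      \<longlonglongrightarrow> (\<integral>\<^sup>+y. exp_minus (\<integral>\<^sup>+i. g i (y i) \<partial>count_space I) \<partial>PiM I N)"
  proof (rule nn_integral_dominated_convergence [where w = "\<lambda>_. 1"])
    show "(\<lambda>y. exp_minus (\<integral>\<^sup>+i. g i (y i) \<partial>count_space I)) \<in> borel_measurable (PiM I N)"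
      by (rule borel_measurable_LIMSEQ_order [OF lim1 meas])
    show "AE y in PiM I N. (\<Prod>i\<in>G n. exp_minus (g i (y i))) \<le> 1" for n
      by (intro AE_I2 prod_le_1) (auto simp: exp_minus_le_1)
    show "(\<integral>\<^sup>+y. 1 \<partial>PiM I N) < \<infinity>"
      using emeasure_space_1 by simp
  qed (auto simp: meas intro: lim1)
  then show ?thesis
    using lim1 [of h] LIMSEQ_unique unfolding comp PiM_eq by blast
qed

section \<open>Laplace functionals of configurations\<close>

text \<open>The linear span of \<open>\<Phi>\<close>, set up for rule induction. If
  \<open>\<Phi>\<close> is closed under products and contains 1, this is an algebra with constants,
  so polynomials in members of \<open>\<Phi>\<close> stay inside it.\<close>

inductive_set fun_span :: "('w \<Rightarrow> real) set \<Rightarrow> ('w \<Rightarrow> real) set" for \<Phi> where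
  base: "\<phi> \<in> \<Phi> \<Longrightarrow> \<phi> \<in> fun_span \<Phi>"
| add: "p \<in> fun_span \<Phi> \<Longrightarrow> q \<in> fun_span \<Phi> \<Longrightarrow> (\<lambda>w. p w + q w) \<in> fun_span \<Phi>"
| scale: "p \<in> fun_span \<Phi> \<Longrightarrow> (\<lambda>w. c * p w) \<in> fun_span \<Phi>"

lemma fun_span_mult:
  assumes mult: "\<And>\<phi> \<psi>. \<phi> \<in> \<Phi> \<Longrightarrow> \<psi> \<in> \<Phi> \<Longrightarrow> (\<lambda>w. \<phi> w * \<psi> w) \<in> \<Phi>"
    and p: "p \<in> fun_span \<Phi>" and q: "q \<in> fun_span \<Phi>"
  shows "(\<lambda>w. p w * q w) \<in> fun_span \<Phi>"
  using p
proof induction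
  case (base \<phi>)
  show ?case
    using q
  proof induction
    case (base \<psi>)
    then show ?case using \<open>\<phi> \<in> \<Phi>\<close> mult fun_span.base by blast
  next
    case (add p q)
    then show ?case using fun_span.add by (fastforce simp: distrib_left)
  next
    case (scale p c)
    then show ?case using fun_span.scale [of "\<lambda>w. \<phi> w * p w" \<Phi> c] by (simp add: mult.left_commute)
  qed
next
  case (add p p')
  then show ?case using fun_span.add by (fastforce simp: distrib_right)
next
  case (scale p c)
  then show ?case using fun_span.scale [of "\<lambda>w. p w * q w" \<Phi> c] by (simp add: mult.assoc)
qed

text \<open>For \<open>0 \<le> q \<le> 1\<close> the powers of \<open>q\<close> decrease to the indicator of \<open>{q = 1}\<close>, and the event
  \<open>{\<phi> = c}\<close> is of this form with \<open>q = 1 - (\<phi> - c)\<^sup>2\<close>. Such events are stable under intersection.\<close>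

lemma kernel_measurable_multiplicative_class:
  fixes K :: "'a \<Rightarrow> 'w measure"
    and \<Phi> :: "('w \<Rightarrow> real) set"
  assumes gen: "sets N = sigma_sets (space N) \<G>"
    and \<G>: "\<And>A. A \<in> \<G> \<Longrightarrow> \<exists>\<phi>\<in>\<Phi>. \<exists>c\<in>{0..1}. A = {w \<in> space N. \<phi> w = c}"
    and meas: "\<And>\<phi>. \<phi> \<in> \<Phi> \<Longrightarrow> \<phi> \<in> borel_measurable N"
    and bound: "\<And>\<phi> w. \<phi> \<in> \<Phi> \<Longrightarrow> w \<in> space N \<Longrightarrow> \<phi> w \<in> {0..1}"
    and one: "(\<lambda>_. 1) \<in> \<Phi>"
    and mult: "\<And>\<phi> \<psi>. \<phi> \<in> \<Phi> \<Longrightarrow> \<psi> \<in> \<Phi> \<Longrightarrow> (\<lambda>w. \<phi> w * \<psi> w) \<in> \<Phi>"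
    and prob: "\<And>a. a \<in> space M \<Longrightarrow> prob_space (K a)"
    and sets: "\<And>a. a \<in> space M \<Longrightarrow> sets (K a) = sets N"
    and int: "\<And>\<phi>. \<phi> \<in> \<Phi> \<Longrightarrow> (\<lambda>a. \<integral>w. \<phi> w \<partial>K a) \<in> borel_measurable M"
  shows "K \<in> measurable M (subprob_algebra N)"
proof -
  have integ: "integrable (K a) p" if "p \<in> borel_measurable N" "\<And>w. w \<in> space N \<Longrightarrow> \<bar>p w\<bar> \<le> C" "a \<in> space M"
    for p and C :: real and a
  proof -
    interpret prob_space "K a" using prob that by simp
    show ?thesis
      using that sets_eq_imp_space_eq [OF sets [OF that(3)]]
      by (intro integrable_const_bound [of _ C]) (auto simp: measurable_cong_sets [OF sets [OF that(3)] refl])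
  qed
  have span: "p \<in> borel_measurable N \<and> (\<exists>C. \<forall>w\<in>space N. \<bar>p w\<bar> \<le> C) \<and>
      (\<lambda>a. \<integral>w. p w \<partial>K a) \<in> borel_measurable M" if "p \<in> fun_span \<Phi>" for p
    using that
  proof induction
    case (base \<phi>)
    then show ?case using meas int bound by (force intro!: exI [of _ 1])
  next
    case (add p q)
    then obtain C D where CD: "\<forall>w\<in>space N. \<bar>p w\<bar> \<le> C" "\<forall>w\<in>space N. \<bar>q w\<bar> \<le> D" by blast
    have "(\<lambda>a. (\<integral>w. p w \<partial>K a) + (\<integral>w. q w \<partial>K a)) \<in> borel_measurable M"
      using add by (intro borel_measurable_add) auto
    also have "?this \<longleftrightarrow> (\<lambda>a. \<integral>w. p w + q w \<partial>K a) \<in> borel_measurable M"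
      using add CD by (intro measurable_cong Bochner_Integration.integral_add [symmetric] integ) auto
    finally have "(\<lambda>a. \<integral>w. p w + q w \<partial>K a) \<in> borel_measurable M" .
    moreover have "\<forall>w\<in>space N. \<bar>p w + q w\<bar> \<le> C + D" using CD by force
    ultimately show ?case using add by (intro conjI borel_measurable_add) auto
  next
    case (scale p c)
    then obtain C where "\<forall>w\<in>space N. \<bar>p w\<bar> \<le> C" by blast
    then have "\<forall>w\<in>space N. \<bar>c * p w\<bar> \<le> \<bar>c\<bar> * C" by (simp add: abs_mult mult_left_mono)
    then show ?case using scale by auto
  qed
  define E where "E = {{w \<in> space N. q w = 1} | q. q \<in> fun_span \<Phi> \<and> (\<forall>w\<in>space N. q w \<in> {0..1})}"
  have one_span: "(\<lambda>_. 1) \<in> fun_span \<Phi>" using one by (rule fun_span.base)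
  have mult_span: "(\<lambda>w. p w * q w) \<in> fun_span \<Phi>" if "p \<in> fun_span \<Phi>" "q \<in> fun_span \<Phi>" for p q
    using that by (intro fun_span_mult [of \<Phi>] mult)
  have "E \<subseteq> sets N"
  proof
    fix A assume "A \<in> E"
    then obtain q where q: "q \<in> fun_span \<Phi>" "A = {w \<in> space N. q w = 1}"
      unfolding E_def by blast
    then have [measurable]: "q \<in> borel_measurable N" using span by simp
    show "A \<in> sets N" unfolding q(2) by measurable
  qed
  moreover have "\<G> \<subseteq> E"
  proof
    fix A assume "A \<in> \<G>"
    then obtain \<phi> c where \<phi>: "\<phi> \<in> \<Phi>" "c \<in> {0..1}" "A = {w \<in> space N. \<phi> w = c}" using \<G> by blast
    \<comment> \<open>The difference of \<open>\<phi>\<close> and c, written in the shape of the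
      span rules. Both lie in [0, 1], so \<bar>r\<bar> \<le> 1; this is what puts 1 - r*r back into
      [0, 1].\<close>
    define r where "r w = \<phi> w + (- c) * 1" for w
    have r: "r \<in> fun_span \<Phi>"
      unfolding r_def by (intro fun_span.add fun_span.scale one_span fun_span.base \<phi>)
    define q where "q w = 1 + (- 1) * (r w * r w)" for w
    have q: "q \<in> fun_span \<Phi>"
      unfolding q_def by (intro fun_span.add fun_span.scale one_span mult_span r)
    have "q w \<in> {0..1}" if "w \<in> space N" for w
    proof -
      have "\<bar>r w\<bar> \<le> 1" using bound [OF \<phi>(1) that] \<phi>(2) by (auto simp: r_def abs_le_iff)
      then show ?thesis using abs_square_le_1 [of "r w"] by (simp add: q_def power2_eq_square)
    qed
    moreover have "A = {w \<in> space N. q w = 1}"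
      using \<phi>(3) by (auto simp: q_def r_def)
    ultimately show "A \<in> E" using q unfolding E_def by blast
  qed
  moreover have "E \<subseteq> Pow (space N)" by (auto simp: E_def)
  ultimately have sets_E: "sets N = sigma_sets (space N) E"
    using gen sigma_sets_mono' [of \<G> E "space N"] sets.sigma_sets_subset [of E N] by auto
  show ?thesis
  proof (rule measurable_subprob_algebra_generated [OF sets_E])
    show "Int_stable E"
    proof (rule Int_stableI)
      fix A B assume "A \<in> E" "B \<in> E"
      then obtain p q where pq: "p \<in> fun_span \<Phi>" "\<forall>w\<in>space N. p w \<in> {0..1}" "A = {w \<in> space N. p w = 1}"
        "q \<in> fun_span \<Phi>" "\<forall>w\<in>space N. q w \<in> {0..1}" "B = {w \<in> space N. q w = 1}"
        unfolding E_def by blast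
      \<comment> \<open>A product of two numbers in [0, 1] is 1 only if both are, since it is
        bounded by each of them.\<close>
      have "p w * q w = 1 \<longleftrightarrow> p w = 1 \<and> q w = 1" if "w \<in> space N" for w
        using pq(2,5) that mult_left_le [of "q w" "p w"] mult_left_le [of "p w" "q w"]
        by (auto simp: mult.commute)
      then have "A \<inter> B = {w \<in> space N. p w * q w = 1}" using pq by auto
      moreover have "\<forall>w\<in>space N. p w * q w \<in> {0..1}" using pq by (auto simp: mult_le_one)
      ultimately show "A \<inter> B \<in> E"
        unfolding E_def using mult_span [OF pq(1,4)]
        by (intro CollectI exI [of _ "\<lambda>w. p w * q w"] conjI)
    qed
    have "emeasure (K a) (space N) = 1" if "a \<in> space M" for a
      using prob_space.emeasure_space_1 [OF prob [OF that]] sets_eq_imp_space_eq [OF sets [OF that]] by simp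
    then show "(\<lambda>a. emeasure (K a) (space N)) \<in> borel_measurable M"
      by (subst measurable_cong [of _ _ "\<lambda>_. 1"]) auto
    fix A assume "A \<in> E"
    then obtain q where q: "q \<in> fun_span \<Phi>" "\<forall>w\<in>space N. q w \<in> {0..1}" "A = {w \<in> space N. q w = 1}"
      unfolding E_def by blast
    have pow: "(\<lambda>w. q w ^ j) \<in> fun_span \<Phi>" for j
      by (induction j) (auto simp: one_span intro: mult_span q(1))
    have A: "A \<in> sets N" using \<open>A \<in> E\<close> \<open>E \<subseteq> sets N\<close> by auto
    \<comment> \<open>Dominated convergence is applied for each a separately. The measure of
      \<open>A\<close> is thereby a sequential limit of integrals of span members, and inherits
      measurability in a.\<close>
    have lim: "(\<lambda>j. \<integral>w. q w ^ j \<partial>K a) \<longlonglongrightarrow> measure (K a) A" if a: "a \<in> space M" for a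
    proof -
      interpret prob_space "K a" using prob a by simp
      have sp: "space (K a) = space N" using sets [OF a] by (rule sets_eq_imp_space_eq)
      have "(\<lambda>j. \<integral>w. q w ^ j \<partial>K a) \<longlonglongrightarrow> (\<integral>w. indicator A w \<partial>K a)"
      proof (rule integral_dominated_convergence [where w = "\<lambda>_. 1"])
        show "AE w in K a. (\<lambda>j. q w ^ j) \<longlonglongrightarrow> indicator A w"
        proof (rule AE_I2)
          fix w assume "w \<in> space (K a)"
          then have "q w \<in> {0..1}" "w \<in> A \<longleftrightarrow> q w = 1" using q sp by auto
          then show "(\<lambda>j. q w ^ j) \<longlonglongrightarrow> indicator A w"
            by (cases "q w = 1") (auto intro!: LIMSEQ_realpow_zero)
        qed
        show "AE w in K a. norm (q w ^ j) \<le> 1" for j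
          using q sp by (intro AE_I2) (auto simp: power_le_one)
      qed (use span [OF pow] A in \<open>auto simp: measurable_cong_sets [OF sets [OF a] refl] sets [OF a]\<close>)
      then show ?thesis using A sets [OF a] by simp
    qed
    have "(\<lambda>a. measure (K a) A) \<in> borel_measurable M"
      by (rule borel_measurable_LIMSEQ_metric [OF _ lim]) (use span [OF pow] in auto)
    then have "(\<lambda>a. ennreal (measure (K a) A)) \<in> borel_measurable M" by simp
    also have "?this \<longleftrightarrow> (\<lambda>a. emeasure (K a) A) \<in> borel_measurable M"
      by (intro measurable_cong finite_measure.emeasure_eq_measure [symmetric]
          prob_space.finite_measure prob)
    finally show "(\<lambda>a. emeasure (K a) A) \<in> borel_measurable M" .
  qed (auto simp: E_def sets prob prob_space_imp_subprob_space)
qed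

section \<open>Configurations and their sigma-algebra\<close>

lemma sets_dirac_sum [simp]: "sets (dirac_sum S I s) = sets (borel_of S)"
  by (simp add: dirac_sum_def)

lemma nn_integral_dirac_sum:
  assumes "s \<in> I \<rightarrow> topspace S" "f \<in> borel_measurable (borel_of S)"
  shows "(\<integral>\<^sup>+x. f x \<partial>dirac_sum S I s) = (\<integral>\<^sup>+i. f (s i) \<partial>count_space I)"
  unfolding dirac_sum_def using assms by (intro nn_integral_distr) auto

text \<open>\<open>configs\<close> admits only sets of naturals as index sets. Any other countable
  index set is carried there by the injection \<open>to_nat_on\<close>, under which counting measure
  is mapped to counting measure.\<close>

lemma dirac_sum_in_configs:
  assumes "countable I" "s \<in> I \<rightarrow> topspace S"
  shows "dirac_sum S I s \<in> configs S"
proof -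
  let ?J = "to_nat_on I ` I" and ?s = "\<lambda>j. s (from_nat_into I j)"
  have "bij_betw (to_nat_on I) I ?J"
    using assms(1) by (simp add: inj_on_imp_bij_betw inj_on_to_nat_on)
  then have "count_space ?J = distr (count_space I) (count_space ?J) (to_nat_on I)"
    by (simp add: distr_bij_count_space)
  moreover have s: "?s \<in> ?J \<rightarrow> topspace S"
    using assms by auto
  ultimately have "dirac_sum S ?J ?s = distr (count_space I) (borel_of S) (?s \<circ> to_nat_on I)"
    unfolding dirac_sum_def using distr_distr [of ?s "count_space ?J" "borel_of S" "to_nat_on I" "count_space I"]
    by auto
  also have "\<dots> = dirac_sum S I s"
    unfolding dirac_sum_def using assms(1) by (intro distr_cong) auto
  finally show ?thesis
    using s unfolding configs_def by (intro CollectI exI [of _ ?J] exI [of _ ?s]) auto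
qed

lemma sets_config: "\<gamma> \<in> configs S \<Longrightarrow> sets \<gamma> = sets (borel_of S)"
  by (auto simp: configs_def)

lemma space_config: "\<gamma> \<in> configs S \<Longrightarrow> space \<gamma> = topspace S"
  using sets_eq_imp_space_eq [OF sets_config] by fastforce

lemma measurable_config: "\<gamma> \<in> configs S \<Longrightarrow> measurable \<gamma> N = measurable (borel_of S) N"
  by (intro measurable_cong_sets sets_config refl)

lemma space_config_space [simp]: "space (config_space S) = configs S"
  by (simp add: config_space_def space_measure_of_conv)

lemma sets_config_space:
  "sets (config_space S) = sigma_sets (configs S)
    {{\<gamma> \<in> configs S. emeasure \<gamma> B = of_nat n} | B (n::nat). B \<in> sets (borel_of S)}"
  unfolding config_space_def by (rule sets_measure_of) auto

lemma config_emeasure_cases: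
  assumes "\<gamma> \<in> configs S"
  obtains "emeasure \<gamma> B = \<infinity>" | n :: nat where "emeasure \<gamma> B = of_nat n"
proof (cases "B \<in> sets \<gamma>")
  case True
  obtain I s where s: "\<gamma> = dirac_sum S I s" "(s :: nat \<Rightarrow> _) \<in> I \<rightarrow> topspace S"
    using assms by (auto simp: configs_def)
  then have "emeasure \<gamma> B = emeasure (count_space I) (s -` B \<inter> I)"
    using True by (simp add: dirac_sum_def emeasure_distr)
  then show ?thesis
    using that by (cases "finite (s -` B \<inter> I)") auto
\<comment> \<open>Off the sigma-algebra \<open>emeasure\<close> has the default value 0, which is
  the case n = 0.\<close>
qed (use that(2) [of 0] in \<open>auto simp: emeasure_notin_sets\<close>)

text \<open>The count takes values in the naturals and \<infinity> only, so preimages are countable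
  unions of level sets. The generators provide the finite levels, and the level \<infinity> is the
  complement of their union.\<close>

lemma measurable_emeasure_config:
  assumes B: "B \<in> sets (borel_of S)"
  shows "(\<lambda>\<gamma>. emeasure \<gamma> B) \<in> borel_measurable (config_space S)"
proof (rule measurableI)
  fix A :: "ennreal set"
  define L where "L n = {\<gamma> \<in> configs S. emeasure \<gamma> B = of_nat n}" for n :: nat
  have L: "L n \<in> sets (config_space S)" for n
    using B unfolding L_def sets_config_space by (intro sigma_sets.Basic) auto
  have "{\<gamma> \<in> configs S. emeasure \<gamma> B \<in> A} =
    (\<Union>n\<in>{n. of_nat n \<in> A}. L n) \<union> (if \<infinity> \<in> A then configs S - (\<Union>n. L n) else {})" (is "?L = ?R")
  proof (intro set_eqI)
    fix \<gamma>
    show "\<gamma> \<in> ?L \<longleftrightarrow> \<gamma> \<in> ?R"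
    proof (cases "\<gamma> \<in> configs S")
      case True
      show ?thesis
        by (rule config_emeasure_cases [OF True, of B]) (use True in \<open>auto simp: L_def\<close>)
    qed (auto simp: L_def)
  qed
  also have "\<dots> \<in> sets (config_space S)"
    using L sets.top [of "config_space S"] by (intro sets.Un sets.countable_UN') auto
  finally show "(\<lambda>\<gamma>. emeasure \<gamma> B) -` A \<inter> space (config_space S) \<in> sets (config_space S)"
    by (simp add: vimage_def Int_def conj_commute)
qed simp

lemma measurable_config_spaceI:
  assumes "f \<in> space M \<rightarrow> configs S"
    "\<And>B. B \<in> sets (borel_of S) \<Longrightarrow> (\<lambda>a. emeasure (f a) B) \<in> borel_measurable M"
  shows "f \<in> measurable M (config_space S)"
  unfolding config_space_def
proof (rule measurable_measure_of)
  fix A assume "A \<in> {{\<gamma> \<in> configs S. emeasure \<gamma> B = of_nat n} | B (n::nat). B \<in> sets (borel_of S)}"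
  then obtain B n where B: "B \<in> sets (borel_of S)" "A = {\<gamma> \<in> configs S. emeasure \<gamma> B = of_nat n}" by blast
  have "f -` A \<inter> space M = {a \<in> space M. emeasure (f a) B = of_nat n}"
    using assms(1) B by auto
  also have "\<dots> \<in> sets M" using assms(2) [OF B(1)] by measurable
  finally show "f -` A \<inter> space M \<in> sets M" .
qed (use assms(1) in auto)

lemma measurable_nn_integral_config:
  assumes "f \<in> borel_measurable (borel_of S)"
  shows "(\<lambda>\<gamma>. \<integral>\<^sup>+x. f x \<partial>\<gamma>) \<in> borel_measurable (config_space S)"
  using assms
proof (induction rule: borel_measurable_induct)
  case (cong f g)
  have "(\<lambda>\<gamma>. \<integral>\<^sup>+x. f x \<partial>\<gamma>) \<in> borel_measurable (config_space S) \<longleftrightarrow>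
    (\<lambda>\<gamma>. \<integral>\<^sup>+x. g x \<partial>\<gamma>) \<in> borel_measurable (config_space S)"
    using cong(3) by (intro measurable_cong nn_integral_cong) (auto simp: space_config)
  then show ?case using cong by simp
next
  case (set A)
  have "(\<lambda>\<gamma>. emeasure \<gamma> A) \<in> borel_measurable (config_space S) \<longleftrightarrow>
    (\<lambda>\<gamma>. \<integral>\<^sup>+x. indicator A x \<partial>\<gamma>) \<in> borel_measurable (config_space S)"
    using set by (intro measurable_cong nn_integral_indicator [symmetric]) (auto simp: sets_config)
  then show ?case using set by (simp add: measurable_emeasure_config)
next
  case (mult u c)
  have "(\<lambda>\<gamma>. c * (\<integral>\<^sup>+x. u x \<partial>\<gamma>)) \<in> borel_measurable (config_space S) \<longleftrightarrow>
    (\<lambda>\<gamma>. \<integral>\<^sup>+x. c * u x \<partial>\<gamma>) \<in> borel_measurable (config_space S)"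
    using mult by (intro measurable_cong nn_integral_cmult [symmetric]) (auto simp: measurable_config)
  then show ?case using mult by simp
next
  case (add u v)
  have "(\<lambda>\<gamma>. (\<integral>\<^sup>+x. v x \<partial>\<gamma>) + (\<integral>\<^sup>+x. u x \<partial>\<gamma>)) \<in> borel_measurable (config_space S) \<longleftrightarrow>
    (\<lambda>\<gamma>. \<integral>\<^sup>+x. v x + u x \<partial>\<gamma>) \<in> borel_measurable (config_space S)"
    using add by (intro measurable_cong nn_integral_add [symmetric]) (auto simp: measurable_config)
  then show ?case using add by simp
next
  case (seq U)
  have "(\<lambda>\<gamma>. SUP i. \<integral>\<^sup>+x. U i x \<partial>\<gamma>) \<in> borel_measurable (config_space S) \<longleftrightarrow>
    (\<lambda>\<gamma>. \<integral>\<^sup>+x. (SUP i. U i x) \<partial>\<gamma>) \<in> borel_measurable (config_space S)"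
    using seq by (intro measurable_cong nn_integral_monotone_convergence_SUP [symmetric])
      (auto simp: measurable_config)
  then show ?case using seq by (simp add: image_comp)
qed

text \<open>The functions exp(-\<langle>f, \<gamma>\<rangle>) form a multiplicative class: exponents
  add, f = 0 gives 1, and an indicator f recovers the generating events as level sets. One statement
  about kernels serves twice, for uniqueness of laws and for measurability of
  \<open>mark_kernel\<close>.\<close>

lemma Laplace_kernel_measurable:
  assumes prob: "\<And>a. a \<in> space M \<Longrightarrow> prob_space (K a)"
    and sets: "\<And>a. a \<in> space M \<Longrightarrow> sets (K a) = sets (config_space S)"
    and int: "\<And>f. f \<in> borel_measurable (borel_of S) \<Longrightarrow> (\<And>x. x \<in> topspace S \<Longrightarrow> 0 \<le> f x) \<Longrightarrow>
      (\<lambda>a. \<integral>\<^sup>+\<gamma>. exp_minus (config_pairing f \<gamma>) \<partial>K a) \<in> borel_measurable M"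
  shows "K \<in> measurable M (subprob_algebra (config_space S))"
proof -
  let ?G = "{{\<gamma> \<in> configs S. emeasure \<gamma> B = of_nat n} | B (n::nat). B \<in> sets (borel_of S)}"
  define F where "F = {f \<in> borel_measurable (borel_of S). \<forall>x\<in>topspace S. 0 \<le> (f x :: real)}"
  \<comment> \<open>Agreement is required on configurations only, because additivity of the pairing
    in f, hence closure under products, is established only there.\<close>
  define \<Phi> where "\<Phi> = {\<phi>. \<exists>f\<in>F. \<forall>\<gamma>\<in>configs S. \<phi> \<gamma> = enn2real (exp_minus (config_pairing f \<gamma>))}"
  have pairing [measurable]: "config_pairing f \<in> borel_measurable (config_space S)" if "f \<in> F" for f
    using that unfolding config_pairing_def F_def by (intro measurable_nn_integral_config measurable_compose [OF _ measurable_ennreal]) simp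
  have fin: "exp_minus t < \<infinity>" for t
    using exp_minus_le_1 [of t] by (rule le_less_trans) simp
  show ?thesis
  proof (rule kernel_measurable_multiplicative_class [where \<G> = ?G and \<Phi> = \<Phi>])
    fix A assume "A \<in> ?G"
    then obtain B n where B: "B \<in> sets (borel_of S)" "A = {\<gamma> \<in> configs S. emeasure \<gamma> B = of_nat n}" by blast
    \<comment> \<open>For f the indicator of B the pairing is the count in B. Injectivity of
      \<open>exp_minus\<close> on [0, \<infinity>] makes exp(-n) characterise the count n; an
      infinite count gives 0 and is never confused with a finite one.\<close>
    have "enn2real (exp_minus (config_pairing (indicator B) \<gamma>)) = exp (- real n) \<longleftrightarrow> emeasure \<gamma> B = of_nat n"
      if "\<gamma> \<in> configs S" for \<gamma>
    proof -
      have "config_pairing (indicator B) \<gamma> = emeasure \<gamma> B"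
        using B sets_config [OF that] by (simp add: config_pairing_def ennreal_indicator)
      moreover have "exp_minus (of_nat n) = ennreal (exp (- real n))"
        using exp_minus_ennreal [of "real n"] by (simp add: ennreal_of_nat_eq_real_of_nat)
      ultimately show ?thesis
        using fin by (metis ennreal_enn2real enn2real_ennreal exp_ge_zero exp_minus_eq_iff infinity_ennreal_def)
    qed
    then have "A = {\<gamma> \<in> space (config_space S). enn2real (exp_minus (config_pairing (indicator B) \<gamma>)) = exp (- real n)}"
      using B by auto
    moreover have "(\<lambda>\<gamma>. enn2real (exp_minus (config_pairing (indicator B) \<gamma>))) \<in> \<Phi>"
      unfolding \<Phi>_def F_def using B by (intro CollectI bexI [of _ "indicator B"]) auto
    ultimately show "\<exists>\<phi>\<in>\<Phi>. \<exists>c\<in>{0..1}. A = {w \<in> space (config_space S). \<phi> w = c}"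
      by (intro bexI [of _ "exp (- real n)"] bexI) auto
  next
    fix \<phi> assume "\<phi> \<in> \<Phi>"
    then obtain f where f: "f \<in> F" "\<And>\<gamma>. \<gamma> \<in> configs S \<Longrightarrow> \<phi> \<gamma> = enn2real (exp_minus (config_pairing f \<gamma>))"
      by (auto simp: \<Phi>_def)
    have m: "(\<lambda>\<gamma>. enn2real (exp_minus (config_pairing f \<gamma>))) \<in> borel_measurable (config_space S)"
      using f(1) by measurable
    then show "\<phi> \<in> borel_measurable (config_space S)"
      using f(2) by (subst measurable_cong) auto
    show "\<phi> \<gamma> \<in> {0..1}" if "\<gamma> \<in> space (config_space S)" for \<gamma>
      using that f(2) [of \<gamma>] exp_minus_le_1 [of "config_pairing f \<gamma>"]
      by (auto intro: enn2real_leI)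
    have "(\<integral>\<gamma>. \<phi> \<gamma> \<partial>K a) = enn2real (\<integral>\<^sup>+\<gamma>. exp_minus (config_pairing f \<gamma>) \<partial>K a)" if "a \<in> space M" for a
    proof -
      have sp: "space (K a) = configs S" using sets_eq_imp_space_eq [OF sets [OF that]] by simp
      have "(\<integral>\<gamma>. \<phi> \<gamma> \<partial>K a) = (\<integral>\<gamma>. enn2real (exp_minus (config_pairing f \<gamma>)) \<partial>K a)"
        using f(2) sp by (intro Bochner_Integration.integral_cong) auto
      also have "\<dots> = enn2real (\<integral>\<^sup>+\<gamma>. ennreal (enn2real (exp_minus (config_pairing f \<gamma>))) \<partial>K a)"
        using m by (intro integral_eq_nn_integral) (auto simp: measurable_cong_sets [OF sets [OF that] refl])
      finally show ?thesis using fin by simp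
    qed
    then have "(\<lambda>a. \<integral>\<gamma>. \<phi> \<gamma> \<partial>K a) \<in> borel_measurable M \<longleftrightarrow>
      (\<lambda>a. enn2real (\<integral>\<^sup>+\<gamma>. exp_minus (config_pairing f \<gamma>) \<partial>K a)) \<in> borel_measurable M"
      by (intro measurable_cong) auto
    then show "(\<lambda>a. \<integral>\<gamma>. \<phi> \<gamma> \<partial>K a) \<in> borel_measurable M"
      using int [of f] f(1) by (auto simp: F_def)
    fix \<psi> assume "\<psi> \<in> \<Phi>"
    then obtain g where g: "g \<in> F" "\<And>\<gamma>. \<gamma> \<in> configs S \<Longrightarrow> \<psi> \<gamma> = enn2real (exp_minus (config_pairing g \<gamma>))"
      by (auto simp: \<Phi>_def)
    have "config_pairing (\<lambda>x. f x + g x) \<gamma> = config_pairing f \<gamma> + config_pairing g \<gamma>" if "\<gamma> \<in> configs S" for \<gamma>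
    proof -
      have sp: "space \<gamma> = topspace S" using that by (rule space_config)
      have "config_pairing (\<lambda>x. f x + g x) \<gamma> = (\<integral>\<^sup>+x. ennreal (f x) + ennreal (g x) \<partial>\<gamma>)"
        unfolding config_pairing_def using f(1) g(1) sp
        by (intro nn_integral_cong ennreal_plus) (auto simp: F_def)
      also have "\<dots> = config_pairing f \<gamma> + config_pairing g \<gamma>"
        unfolding config_pairing_def using f(1) g(1)
        by (intro nn_integral_add) (auto simp: F_def measurable_config [OF that])
      finally show ?thesis .
    qed
    then show "(\<lambda>\<gamma>. \<phi> \<gamma> * \<psi> \<gamma>) \<in> \<Phi>"
      unfolding \<Phi>_def using f g
      by (intro CollectI bexI [of _ "\<lambda>x. f x + g x"]) (auto simp: F_def exp_minus_add enn2real_mult)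
  next
    show "(\<lambda>_. 1) \<in> \<Phi>"
      unfolding \<Phi>_def by (intro CollectI bexI [of _ "\<lambda>_. 0"]) (auto simp: F_def config_pairing_def)
  qed (auto simp: prob sets sets_config_space)
qed

text \<open>A measurable kernel on a two-point set with the trivial \<open>\<sigma>\<close>-algebra is constant.\<close>

lemma Laplace_unique:
  assumes "prob_space P" "prob_space Q" "sets P = sets (config_space S)" "sets Q = sets (config_space S)"
    and eq: "\<And>f. f \<in> borel_measurable (borel_of S) \<Longrightarrow> (\<And>x. x \<in> topspace S \<Longrightarrow> 0 \<le> f x) \<Longrightarrow>
      (\<integral>\<^sup>+\<gamma>. exp_minus (config_pairing f \<gamma>) \<partial>P) = (\<integral>\<^sup>+\<gamma>. exp_minus (config_pairing f \<gamma>) \<partial>Q)"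
  shows "P = Q"
proof (rule measure_eqI)
  fix A assume "A \<in> sets P"
  define T where "T = sigma (UNIV :: bool set) {}"
  have T: "sets T = {{}, UNIV}" "space T = UNIV"
    by (simp_all add: T_def sigma_sets_empty_eq space_measure_of_conv)
  define K where "K b = (if b then P else Q)" for b
  have "K \<in> measurable T (subprob_algebra (config_space S))"
  proof (rule Laplace_kernel_measurable)
    fix f :: "'a \<Rightarrow> real"
    assume "f \<in> borel_measurable (borel_of S)" "\<And>x. x \<in> topspace S \<Longrightarrow> 0 \<le> f x"
    then have "(\<lambda>b. \<integral>\<^sup>+\<gamma>. exp_minus (config_pairing f \<gamma>) \<partial>K b) = (\<lambda>b. \<integral>\<^sup>+\<gamma>. exp_minus (config_pairing f \<gamma>) \<partial>P)"
      using eq by (auto simp: K_def)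
    then show "(\<lambda>b. \<integral>\<^sup>+\<gamma>. exp_minus (config_pairing f \<gamma>) \<partial>K b) \<in> borel_measurable T" by simp
  qed (use assms in \<open>auto simp: K_def\<close>)
  moreover have "(\<lambda>L. emeasure L A) \<in> borel_measurable (subprob_algebra (config_space S))"
    using \<open>A \<in> sets P\<close> assms(3) by (intro measurable_emeasure_subprob_algebra) simp
  ultimately have "(\<lambda>b. emeasure (K b) A) \<in> borel_measurable T"
    by (rule measurable_compose)
  then have "(\<lambda>b. emeasure (K b) A) -` {emeasure P A} \<inter> space T \<in> sets T"
    by (rule measurable_sets) simp
  then have "{b. emeasure (K b) A = emeasure P A} = {} \<or> {b. emeasure (K b) A = emeasure P A} = UNIV"
    by (simp add: T vimage_def)
  moreover have "emeasure (K True) A = emeasure P A" by (simp add: K_def)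
  ultimately have "emeasure (K False) A = emeasure P A" by blast
  then show "emeasure P A = emeasure Q A" by (simp add: K_def)
qed (simp add: assms)

section \<open>Listing the points of a configuration\<close>

lemma emeasure_dirac_sum_count_space:
  assumes "s \<in> I \<rightarrow> topspace S" "B \<in> sets (borel_of S)"
  shows "emeasure (dirac_sum S I s) B = emeasure (count_space I) (s -` B \<inter> I)"
  using assms by (simp add: dirac_sum_def emeasure_distr)

text \<open>If x lies outside the space, its singleton is not measurable, so the default value 0 of
  \<open>emeasure\<close> leaves no index over x.\<close>

lemma config_index_subset:
  assumes "\<gamma> \<in> configs S"
  shows "fst \<in> config_index \<gamma> \<rightarrow> topspace S"
proof clarsimp
  fix x k assume "(x, k) \<in> config_index \<gamma>"
  then have "emeasure \<gamma> {x} \<noteq> 0" by (auto simp: config_index_def)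
  then have "{x} \<in> sets \<gamma>" by (metis emeasure_notin_sets)
  then show "x \<in> topspace S" using sets.sets_into_space [of "{x}" \<gamma>] space_config [OF assms] by auto
qed

lemma countable_config_index:
  assumes "\<gamma> \<in> configs S"
  shows "countable (config_index \<gamma>)"
proof -
  obtain I s where s: "\<gamma> = dirac_sum S I s" "(s :: nat \<Rightarrow> _) \<in> I \<rightarrow> topspace S"
    using assms by (auto simp: configs_def)
  have "emeasure \<gamma> {x} = 0" if "x \<notin> s ` I" for x
  proof (cases "{x} \<in> sets (borel_of S)")
    case True
    have "s -` {x} \<inter> I = {}" using that by auto
    then show ?thesis using True s by (simp add: emeasure_dirac_sum_count_space)
  qed (simp add: s(1) emeasure_notin_sets)
  then have "config_index \<gamma> \<subseteq> s ` I \<times> UNIV"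
    by (fastforce simp: config_index_def)
  then show ?thesis by (rule countable_subset) auto
qed

text \<open>Replaces an arbitrary enumeration by an index set determined by \<open>\<gamma>\<close>
  alone. Both measures are carried by a countable set, and points are Borel by T1, so it suffices to
  compare singletons; over x the index set has exactly as many elements as the mass of x.\<close>

lemma config_eq_dirac_sum:
  assumes "t1_space S" "\<gamma> \<in> configs S"
  shows "\<gamma> = dirac_sum S (config_index \<gamma>) fst"
proof (rule measure_eqI)
  show "sets \<gamma> = sets (dirac_sum S (config_index \<gamma>) fst)"
    using assms by (simp add: sets_config)
  fix B assume "B \<in> sets \<gamma>"
  then have B: "B \<in> sets (borel_of S)" using assms by (simp add: sets_config)
  obtain I s where s: "\<gamma> = dirac_sum S I s" "(s :: nat \<Rightarrow> _) \<in> I \<rightarrow> topspace S"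
    using assms by (auto simp: configs_def)
  \<comment> \<open>The set must carry both measures: the first summand carries
    \<open>\<gamma>\<close>, the second the canonical sum.\<close>
  define C where "C = s ` I \<union> fst ` config_index \<gamma>"
  note index = config_index_subset [OF assms(2)]
  have C: "countable C" "C \<subseteq> topspace S"
    using countable_config_index [OF assms(2)] index s(2) by (auto simp: C_def)
  have single: "{x} \<in> sets (borel_of S)" if "x \<in> topspace S" for x
    using closedin_t1_singleton [OF assms(1) that] by (rule closedin_in_borel_of)
  have BC: "B \<inter> C \<in> sets (borel_of S)"
  proof (rule sets.Int [OF B])
    show "C \<in> sets (borel_of S)"
      by (rule sets.countable) (use C single in \<open>auto simp: subset_iff\<close>)
  qed
  have point: "emeasure (dirac_sum S (config_index \<gamma>) fst) {x} = emeasure \<gamma> {x}" if x: "x \<in> topspace S" for x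
  proof -
    have "fst -` {x} \<inter> config_index \<gamma> = Pair x ` {k. of_nat k < emeasure \<gamma> {x}}"
      by (auto simp: config_index_def)
    then have "emeasure (dirac_sum S (config_index \<gamma>) fst) {x} =
        emeasure (count_space (config_index \<gamma>)) (Pair x ` {k. of_nat k < emeasure \<gamma> {x}})"
      using index x by (simp add: emeasure_dirac_sum_count_space single)
    also have "\<dots> = emeasure (count_space UNIV) (Pair x ` {k. of_nat k < emeasure \<gamma> {x}})"
      by (subst (1 2) emeasure_count_space) (auto simp: config_index_def)
    also have "\<dots> = emeasure \<gamma> {x}"
    proof (rule config_emeasure_cases [OF assms(2), of "{x}"])
      assume "emeasure \<gamma> {x} = \<infinity>"
      then have "{k :: nat. of_nat k < emeasure \<gamma> {x}} = UNIV" by (auto simp: of_nat_less_top)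
      then show ?thesis
        using \<open>emeasure \<gamma> {x} = \<infinity>\<close> by (simp add: emeasure_count_space finite_image_iff inj_on_def)
    next
      fix n :: nat assume n: "emeasure \<gamma> {x} = of_nat n"
      then have "{k :: nat. of_nat k < emeasure \<gamma> {x}} = {..<n}" by auto
      then show ?thesis using n by (simp add: card_image inj_on_def)
    qed
    finally show ?thesis .
  qed
  have "emeasure \<gamma> B = emeasure \<gamma> (B \<inter> C)"
    using s B BC by (auto simp: emeasure_dirac_sum_count_space C_def intro!: arg_cong2 [where f = emeasure])
  also have "\<dots> = (\<integral>\<^sup>+x. emeasure \<gamma> {x} \<partial>count_space (B \<inter> C))"
    using C single s(1) by (intro emeasure_countable_singleton) auto
  also have "\<dots> = (\<integral>\<^sup>+x. emeasure (dirac_sum S (config_index \<gamma>) fst) {x} \<partial>count_space (B \<inter> C))"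
    using C point by (intro nn_integral_cong) auto
  also have "\<dots> = emeasure (dirac_sum S (config_index \<gamma>) fst) (B \<inter> C)"
    using C single by (intro emeasure_countable_singleton [symmetric]) auto
  also have "\<dots> = emeasure (dirac_sum S (config_index \<gamma>) fst) B"
    using index B BC by (auto simp: emeasure_dirac_sum_count_space C_def intro!: arg_cong2 [where f = emeasure])
  finally show "emeasure \<gamma> B = emeasure (dirac_sum S (config_index \<gamma>) fst) B" .
qed

lemma nn_integral_config_index:
  assumes "t1_space S" "\<gamma> \<in> configs S" "h \<in> borel_measurable (borel_of S)"
  shows "(\<integral>\<^sup>+x. h x \<partial>\<gamma>) = (\<integral>\<^sup>+i. h (fst i) \<partial>count_space (config_index \<gamma>))"
  by (subst config_eq_dirac_sum [OF assms(1,2)])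
    (intro nn_integral_dirac_sum config_index_subset assms)

text \<open>\<open>Lim\<close> has a known value only once a limit is exhibited. With h as the
  negative logarithm of the factors, the finite partial products are exponentials of partial sums,
  whose net converges in [0, \<infinity>].\<close>

lemma config_prod_exp_minus:
  assumes "t1_space S" "\<gamma> \<in> configs S" "h \<in> borel_measurable (borel_of S)"
    and "\<And>x. x \<in> topspace S \<Longrightarrow> exp_minus (h x) = \<phi> x"
  shows "config_prod \<gamma> \<phi> = exp_minus (\<integral>\<^sup>+x. h x \<partial>\<gamma>)"
  unfolding config_prod_def nn_integral_config_index [OF assms(1-3)]
proof (rule tendsto_Lim)
  have "(\<Prod>i\<in>F. exp_minus (h (fst i))) = (\<Prod>(x, k)\<in>F. \<phi> x)" if "F \<subseteq> config_index \<gamma>" for F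
  proof (intro prod.cong refl)
    fix i assume "i \<in> F"
    then have "fst i \<in> topspace S" using that config_index_subset [OF assms(2)] by blast
    then show "exp_minus (h (fst i)) = (case i of (x, k) \<Rightarrow> \<phi> x)"
      using assms(4) by (simp add: case_prod_beta)
  qed
  then have "eventually (\<lambda>F. (\<Prod>i\<in>F. exp_minus (h (fst i))) = (\<Prod>(x, k)\<in>F. \<phi> x))
      (finite_subsets_at_top (config_index \<gamma>))"
    by (intro eventually_finite_subsets_at_top_weakI)
  then show "((\<lambda>F. \<Prod>(x, k)\<in>F. \<phi> x) \<longlongrightarrow> exp_minus (\<integral>\<^sup>+i. h (fst i) \<partial>count_space (config_index \<gamma>)))
      (finite_subsets_at_top (config_index \<gamma>))"
    using tendsto_prod_exp_minus [OF countable_config_index [OF assms(2)], of "\<lambda>i. h (fst i)"]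
    by (simp cong: filterlim_cong add: tendsto_cong)
qed simp

section \<open>Clusters and their superposition\<close>

lemma topspace_cluster_topology:
  "topspace (cluster_topology X) = {y. snd y \<in> cluster_ix y \<rightarrow>\<^sub>E topspace X}"
  by (auto simp: cluster_topology_def cluster_ix_def o_def)

lemma cluster_in_topspace: "y \<in> topspace (cluster_topology X) \<Longrightarrow> snd y \<in> cluster_ix y \<rightarrow> topspace X"
  by (auto simp: topspace_cluster_topology)

text \<open>Openness in a disjoint union is tested on each summand: for length n > i the set is an
  open cylinder, otherwise it is empty.\<close>

lemma openin_cluster_coordinate:
  assumes "openin X U"
  shows "openin (cluster_topology X) {y \<in> topspace (cluster_topology X). i \<in> cluster_ix y \<and> snd y i \<in> U}"
  unfolding cluster_topology_def openin_sum_topology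
proof (intro conjI ballI)
  fix n :: enat
  let ?P = "product_topology (\<lambda>_. X) {i. enat i < n}"
  show "openin ?P {x. (n, x) \<in> {y \<in> topspace (sum_topology (\<lambda>n. product_topology (\<lambda>_. X) {i. enat i < n}) UNIV).
      i \<in> cluster_ix y \<and> snd y i \<in> U}}"
  proof (cases "enat i < n")
    case True
    then have "openin ?P {x \<in> topspace ?P. x i \<in> U}"
      using openin_continuous_map_preimage [OF continuous_map_product_projection [of i "{i. enat i < n}" "\<lambda>_. X"] assms]
      by simp
    then show ?thesis using True by (simp add: cluster_ix_def)
  qed (simp add: cluster_ix_def)
qed auto

text \<open>Coordinate i exists only on clusters longer than i; on shorter ones it is
  \<open>undefined\<close>, which need not be a point of \<open>X\<close>. Hence the restriction to
  the domain and the indicator factor.\<close>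

lemma measurable_cluster_coordinate:
  fixes f :: "'a \<Rightarrow> ennreal"
  assumes f: "f \<in> borel_measurable (borel_of X)"
  shows "(\<lambda>y. f (snd y i) * indicator {y. i \<in> cluster_ix y} y) \<in> borel_measurable (borel_of (cluster_topology X))"
proof -
  let ?C = "borel_of (cluster_topology X)" and ?D = "{y :: 'a cluster. i \<in> cluster_ix y}"
  have pre: "{y \<in> topspace (cluster_topology X). i \<in> cluster_ix y \<and> snd y i \<in> U} \<in> sets ?C" if "openin X U" for U
    using openin_cluster_coordinate [OF that] by (rule openin_in_borel_of)
  have "{y \<in> topspace (cluster_topology X). i \<in> cluster_ix y \<and> snd y i \<in> topspace X} = ?D \<inter> space ?C"
    using cluster_in_topspace by fastforce
  then have D: "?D \<inter> space ?C \<in> sets ?C"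
    using pre [of "topspace X"] by simp
  have "(\<lambda>y. snd y i) \<in> measurable (restrict_space ?C ?D) (borel_of X)"
    unfolding borel_of_def [of X]
  proof (rule measurable_measure_of)
    show "(\<lambda>y. snd y i) \<in> space (restrict_space ?C ?D) \<rightarrow> topspace X"
      using cluster_in_topspace by (fastforce simp: space_restrict_space)
    fix U assume "U \<in> {U. openin X U}"
    moreover have "(\<lambda>y. snd y i) -` U \<inter> space (restrict_space ?C ?D) =
        {y \<in> topspace (cluster_topology X). i \<in> cluster_ix y \<and> snd y i \<in> U}"
      by (auto simp: space_restrict_space)
    ultimately show "(\<lambda>y. snd y i) -` U \<inter> space (restrict_space ?C ?D) \<in> sets (restrict_space ?C ?D)"
      using pre [of U] D by (auto simp: sets_restrict_space_iff)
  qed (auto dest: openin_subset)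
  from measurable_compose [OF this f] show ?thesis
    using D by (simp add: borel_measurable_restrict_space_iff_ennreal)
qed

lemma nn_integral_cluster_config:
  assumes "y \<in> topspace (cluster_topology X)" "f \<in> borel_measurable (borel_of X)"
  shows "(\<integral>\<^sup>+x. f x \<partial>cluster_config X y) = (\<integral>\<^sup>+i. f (snd y i) \<partial>count_space (cluster_ix y))"
  unfolding cluster_config_def by (intro nn_integral_dirac_sum cluster_in_topspace assms)

lemma measurable_nn_integral_cluster_config:
  assumes f: "f \<in> borel_measurable (borel_of X)"
  shows "(\<lambda>y. \<integral>\<^sup>+x. f x \<partial>cluster_config X y) \<in> borel_measurable (borel_of (cluster_topology X))"
proof -
  \<comment> \<open>Indicators turn the index set, which varies with y, into the fixed set of all
    naturals, so that a countable sum of measurable functions remains.\<close>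
  have "(\<integral>\<^sup>+x. f x \<partial>cluster_config X y) = (\<Sum>i. f (snd y i) * indicator {y. i \<in> cluster_ix y} y)"
    if "y \<in> topspace (cluster_topology X)" for y
  proof -
    have "(\<integral>\<^sup>+x. f x \<partial>cluster_config X y) = (\<integral>\<^sup>+i. f (snd y i) * indicator (cluster_ix y) i \<partial>count_space UNIV)"
      using that f by (simp add: nn_integral_cluster_config nn_integral_count_space_indicator)
    then show ?thesis
      by (simp add: nn_integral_count_space_nat indicator_def)
  qed
  then show ?thesis
    by (subst measurable_cong) (auto intro!: borel_measurable_suminf_order measurable_cluster_coordinate f)
qed

lemma measurable_nn_integral_skew:
  assumes "f \<in> borel_measurable (borel_of X)"
  shows "(\<lambda>z. \<integral>\<^sup>+x. f x \<partial>cluster_config X (snd z)) \<in> borel_measurable (borel_of (skew_topology X))"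
  unfolding skew_topology_def
  by (intro measurable_compose [OF continuous_map_borel_measurable [OF continuous_map_snd]]
      measurable_nn_integral_cluster_config assms)

text \<open>\<open>cluster_union\<close> applies \<open>measure_of\<close> to a set function, which
  is faithful only if that function is a measure. Writing it as one sum of Dirac measures over all
  cluster points proves this, and also gives the integral formula through Fubini for counting
  measures.\<close>

lemma
  assumes \<zeta>: "\<zeta> \<in> configs (skew_topology X)"
  shows cluster_union_in_configs: "cluster_union X \<zeta> \<in> configs X"
    and nn_integral_cluster_union: "f \<in> borel_measurable (borel_of X) \<Longrightarrow>
      (\<integral>\<^sup>+x. f x \<partial>cluster_union X \<zeta>) = (\<integral>\<^sup>+z. (\<integral>\<^sup>+x. f x \<partial>cluster_config X (snd z)) \<partial>\<zeta>)"
proof -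
  obtain I z where z: "\<zeta> = dirac_sum (skew_topology X) I z" "(z :: nat \<Rightarrow> _) \<in> I \<rightarrow> topspace (skew_topology X)"
    using \<zeta> by (auto simp: configs_def)
  have zC: "snd (z i) \<in> topspace (cluster_topology X)" if "i \<in> I" for i
    using funcset_mem [OF z(2) that] by (auto simp: skew_topology_def mem_Times_iff)
  \<comment> \<open>The pair (i, j) stands for the j-th point of the i-th cluster, so multiplicities
    are kept.\<close>
  define W where "W = (SIGMA i:I. cluster_ix (snd (z i)))"
  define w where "w = (\<lambda>(i, j). snd (snd (z i)) j)"
  have w: "w \<in> W \<rightarrow> topspace X"
    using cluster_in_topspace zC by (fastforce simp: W_def w_def)
  have sum: "(\<integral>\<^sup>+x. f x \<partial>dirac_sum X W w) = (\<integral>\<^sup>+z. (\<integral>\<^sup>+x. f x \<partial>cluster_config X (snd z)) \<partial>\<zeta>)"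
    if f: "f \<in> borel_measurable (borel_of X)" for f
  proof -
    have "(\<integral>\<^sup>+x. f x \<partial>dirac_sum X W w) = (\<integral>\<^sup>+p. f (w p) * indicator W p \<partial>count_space UNIV)"
      using w f by (simp add: nn_integral_dirac_sum nn_integral_count_space_indicator)
    also have "\<dots> = (\<integral>\<^sup>+i. \<integral>\<^sup>+j. f (w (i, j)) * indicator W (i, j) \<partial>count_space UNIV \<partial>count_space UNIV)"
      by (rule nn_integral_fst_count_space [symmetric])
    also have "\<dots> = (\<integral>\<^sup>+i. (\<integral>\<^sup>+j. f (w (i, j)) * indicator (cluster_ix (snd (z i))) j \<partial>count_space UNIV) *
        indicator I i \<partial>count_space UNIV)"
      by (intro nn_integral_cong) (auto simp: W_def indicator_def)
    also have "\<dots> = (\<integral>\<^sup>+i. (\<integral>\<^sup>+j. f (w (i, j)) \<partial>count_space (cluster_ix (snd (z i)))) \<partial>count_space I)"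
      by (simp add: nn_integral_count_space_indicator)
    also have "\<dots> = (\<integral>\<^sup>+i. (\<integral>\<^sup>+x. f x \<partial>cluster_config X (snd (z i))) \<partial>count_space I)"
      using zC f by (intro nn_integral_cong) (simp add: nn_integral_cluster_config w_def)
    also have "\<dots> = (\<integral>\<^sup>+z. (\<integral>\<^sup>+x. f x \<partial>cluster_config X (snd z)) \<partial>\<zeta>)"
      unfolding z(1) using z(2) measurable_nn_integral_skew [OF f] by (simp add: nn_integral_dirac_sum)
    finally show ?thesis .
  qed
  have "cluster_union X \<zeta> = measure_of (topspace X) (sets (borel_of X)) (emeasure (dirac_sum X W w))"
    unfolding cluster_union_def
  proof (rule measure_of_eq)
    show "sets (borel_of X) \<subseteq> Pow (topspace X)"
      using sets.space_closed [of "borel_of X"] by simp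
    fix B assume "B \<in> sigma_sets (topspace X) (sets (borel_of X))"
    then have B: "B \<in> sets (borel_of X)"
      using sets.sigma_sets_eq [of "borel_of X"] by simp
    then have "emeasure (dirac_sum X W w) B = (\<integral>\<^sup>+z. (\<integral>\<^sup>+x. indicator B x \<partial>cluster_config X (snd z)) \<partial>\<zeta>)"
      by (simp flip: sum)
    then show "(\<integral>\<^sup>+(x, y). emeasure (cluster_config X y) B \<partial>\<zeta>) = emeasure (dirac_sum X W w) B"
      using B by (simp add: cluster_config_def case_prod_unfold)
  qed
  also have "\<dots> = dirac_sum X W w"
    using measure_of_of_measure [of "dirac_sum X W w"] by (simp add: dirac_sum_def)
  finally have eq: "cluster_union X \<zeta> = dirac_sum X W w" .
  show "cluster_union X \<zeta> \<in> configs X"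
    unfolding eq using w by (intro dirac_sum_in_configs) (auto simp: W_def)
  show "(\<integral>\<^sup>+x. f x \<partial>cluster_union X \<zeta>) = (\<integral>\<^sup>+z. (\<integral>\<^sup>+x. f x \<partial>cluster_config X (snd z)) \<partial>\<zeta>)"
    if "f \<in> borel_measurable (borel_of X)"
    unfolding eq using that by (rule sum)
qed

lemma measurable_cluster_union:
  "cluster_union X \<in> measurable (config_space (skew_topology X)) (config_space X)"
proof (rule measurable_config_spaceI)
  fix B assume B: "B \<in> sets (borel_of X)"
  have "emeasure (cluster_union X \<zeta>) B = (\<integral>\<^sup>+z. (\<integral>\<^sup>+x. indicator B x \<partial>cluster_config X (snd z)) \<partial>\<zeta>)"
    if "\<zeta> \<in> configs (skew_topology X)" for \<zeta>
    using B sets_config [OF cluster_union_in_configs [OF that]]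
    by (simp flip: nn_integral_cluster_union [OF that])
  then show "(\<lambda>\<zeta>. emeasure (cluster_union X \<zeta>) B) \<in> borel_measurable (config_space (skew_topology X))"
    using B by (subst measurable_cong)
      (auto intro!: measurable_nn_integral_config measurable_nn_integral_skew simp del: nn_integral_indicator)
qed (auto intro: cluster_union_in_configs)

lemma is_cluster_measureD:
  assumes "is_cluster_measure X \<eta> \<mu> \<nu>"
  shows "prob_space \<nu>" "sets \<nu> = sets (config_space X)"
    and "f \<in> borel_measurable (borel_of X) \<Longrightarrow> \<forall>x\<in>topspace X. 0 \<le> f x \<Longrightarrow>
      (\<integral>\<^sup>+\<gamma>. exp_minus (config_pairing f \<gamma>) \<partial>\<nu>) =
      (\<integral>\<^sup>+\<gamma>. config_prod \<gamma>
        (\<lambda>x. \<integral>\<^sup>+y. exp_minus (\<Sum>\<^sub>\<infinity>i\<in>cluster_ix y. ennreal (f (snd y i))) \<partial>\<eta> x) \<partial>\<mu>)"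
  using assms unfolding is_cluster_measure_def by blast+

lemma is_skew_measureD:
  assumes "is_skew_measure X \<eta> \<mu> \<nu>"
  shows "prob_space \<nu>" "sets \<nu> = sets (config_space (skew_topology X))"
    and "F \<in> borel_measurable (config_space (skew_topology X)) \<Longrightarrow>
      (\<integral>\<^sup>+\<zeta>. F \<zeta> \<partial>\<nu>) = (\<integral>\<^sup>+\<gamma>. (\<integral>\<^sup>+y. F (marked_config X \<gamma> y) \<partial>cluster_product \<eta> \<gamma>) \<partial>\<mu>)"
  using assms unfolding is_skew_measure_def by blast+

section \<open>The skew-product measure\<close>

text \<open>Polishness enters through two consequences: T1 makes points Borel, and second
  countability places the Borel sets of \<open>skew_topology X\<close> in the product
  sigma-algebra.\<close>

locale cluster_field =
  fixes X :: "'a topology" and \<eta> :: "'a \<Rightarrow> 'a cluster measure"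
  assumes t1: "t1_space X" and second_countable: "second_countable X"
    and \<eta>_prob: "\<And>x. x \<in> topspace X \<Longrightarrow> prob_space (\<eta> x)"
    and \<eta>_sets: "\<And>x. x \<in> topspace X \<Longrightarrow> sets (\<eta> x) = sets (borel_of (cluster_topology X))"
    and \<eta>_measurable: "\<And>B. B \<in> sets (borel_of (cluster_topology X)) \<Longrightarrow>
      (\<lambda>x. emeasure (\<eta> x) B) \<in> borel_measurable (borel_of X)"
begin

abbreviation Z :: "('a \<times> 'a cluster) topology" where "Z \<equiv> skew_topology X"

lemma \<eta>_kernel: "\<eta> \<in> measurable (borel_of X) (subprob_algebra (borel_of (cluster_topology X)))"
  by (rule measurable_subprob_algebra)
    (auto simp: \<eta>_prob \<eta>_sets \<eta>_measurable prob_space_imp_subprob_space)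

section \<open>Independent marks on a fixed configuration\<close>

lemma fst_config_index: "\<gamma> \<in> configs X \<Longrightarrow> i \<in> config_index \<gamma> \<Longrightarrow> fst i \<in> topspace X"
  using config_index_subset by blast

lemma cluster_product_eq: "cluster_product \<eta> \<gamma> = PiM (config_index \<gamma>) (\<lambda>i. \<eta> (fst i))"
  by (simp add: cluster_product_def case_prod_unfold)

lemma prob_space_cluster_product: "\<gamma> \<in> configs X \<Longrightarrow> prob_space (cluster_product \<eta> \<gamma>)"
  unfolding cluster_product_eq by (intro prob_space_PiM \<eta>_prob fst_config_index)

lemma marked_points:
  assumes "\<gamma> \<in> configs X" "y \<in> space (cluster_product \<eta> \<gamma>)"
  shows "(\<lambda>i. (fst i, y i)) \<in> config_index \<gamma> \<rightarrow> topspace Z"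
proof
  fix i assume i: "i \<in> config_index \<gamma>"
  then have "y i \<in> space (\<eta> (fst i))"
    using assms(2) by (auto simp: cluster_product_eq space_PiM PiE_iff)
  then show "(fst i, y i) \<in> topspace Z"
    using fst_config_index [OF assms(1) i] sets_eq_imp_space_eq [OF \<eta>_sets] by (simp add: skew_topology_def)
qed

lemma marked_config_eq: "marked_config X \<gamma> y = dirac_sum Z (config_index \<gamma>) (\<lambda>i. (fst i, y i))"
  by (simp add: marked_config_def case_prod_unfold)

lemma marked_config_in_configs:
  assumes "\<gamma> \<in> configs X" "y \<in> space (cluster_product \<eta> \<gamma>)"
  shows "marked_config X \<gamma> y \<in> configs Z"
  unfolding marked_config_eq using assms
  by (intro dirac_sum_in_configs marked_points countable_config_index)

lemma nn_integral_marked_config: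
  assumes "\<gamma> \<in> configs X" "y \<in> space (cluster_product \<eta> \<gamma>)" "g \<in> borel_measurable (borel_of Z)"
  shows "(\<integral>\<^sup>+z. g z \<partial>marked_config X \<gamma> y) = (\<integral>\<^sup>+i. g (fst i, y i) \<partial>count_space (config_index \<gamma>))"
  unfolding marked_config_eq using assms by (intro nn_integral_dirac_sum marked_points)

lemma measurable_section:
  assumes "x \<in> topspace X" "g \<in> measurable (borel_of Z) N"
  shows "(\<lambda>y. g (x, y)) \<in> measurable (\<eta> x) N"
proof -
  have "continuous_map (cluster_topology X) Z (\<lambda>y. (x, y))"
    using assms(1) by (simp add: skew_topology_def continuous_map_paired)
  then have "(\<lambda>y. g (x, y)) \<in> measurable (borel_of (cluster_topology X)) N"
    by (intro measurable_compose [OF continuous_map_borel_measurable assms(2)])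
  then show ?thesis
    by (simp add: measurable_cong_sets [OF \<eta>_sets [OF assms(1)] refl])
qed

lemma measurable_marked_section:
  assumes "\<gamma> \<in> configs X" "i \<in> config_index \<gamma>" "g \<in> measurable (borel_of Z) N"
  shows "(\<lambda>y. g (fst i, y i)) \<in> measurable (cluster_product \<eta> \<gamma>) N"
  unfolding cluster_product_eq
  by (rule measurable_compose [OF measurable_component_singleton [OF assms(2)]])
    (intro measurable_section fst_config_index [OF assms(1,2)] assms(3))

lemma measurable_marked_config:
  assumes "\<gamma> \<in> configs X"
  shows "marked_config X \<gamma> \<in> measurable (cluster_product \<eta> \<gamma>) (config_space Z)"
proof (rule measurable_config_spaceI)
  fix B assume B: "B \<in> sets (borel_of Z)"
  have "emeasure (marked_config X \<gamma> y) B = (\<integral>\<^sup>+i. indicator B (fst i, y i) \<partial>count_space (config_index \<gamma>))"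
    if "y \<in> space (cluster_product \<eta> \<gamma>)" for y
    using B nn_integral_marked_config [OF assms that, of "indicator B"]
    by (simp add: marked_config_eq)
  then show "(\<lambda>y. emeasure (marked_config X \<gamma> y) B) \<in> borel_measurable (cluster_product \<eta> \<gamma>)"
    using assms B by (subst measurable_cong)
      (auto intro!: borel_measurable_nn_integral_count_space countable_config_index measurable_marked_section)
qed (auto intro: marked_config_in_configs assms)

text \<open>\<open>g\<close> is extended-valued because the sum of f over an infinite cluster may
  diverge. \<open>\<phi>\<close> is prescribed only on the space, where \<open>\<eta>\<close> is
  controlled, so factors written in another form can be substituted.\<close>

context
  fixes g :: "'a \<times> 'a cluster \<Rightarrow> ennreal" and \<phi> :: "'a \<Rightarrow> ennreal"
  assumes g: "g \<in> borel_measurable (borel_of Z)"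
    and \<phi>: "\<And>x. x \<in> topspace X \<Longrightarrow> \<phi> x = (\<integral>\<^sup>+y. exp_minus (g (x, y)) \<partial>\<eta> x)"
begin

text \<open>Integrating out y against a kernel needs measurability for the product sigma-algebra,
  while \<open>g\<close> is Borel for the product topology; second countability bridges the
  two.\<close>

lemma measurable_minus_log_factor: "(\<lambda>x. minus_log (\<phi> x)) \<in> borel_measurable (borel_of X)"
proof -
  have "g \<in> borel_measurable (borel_of X \<Otimes>\<^sub>M borel_of (cluster_topology X))"
    using g unfolding skew_topology_def by (rule measurable_borel_of_prod [OF second_countable])
  then have "(\<lambda>(x, y). exp_minus (g (x, y))) \<in>
      borel_measurable (borel_of X \<Otimes>\<^sub>M borel_of (cluster_topology X))"
    by (simp add: measurable_compose [OF _ measurable_exp_minus])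
  from nn_integral_measurable_subprob_algebra2 [OF this \<eta>_kernel]
  have "\<phi> \<in> borel_measurable (borel_of X)"
    using \<phi> by (subst measurable_cong) auto
  then show ?thesis by measurable
qed

lemma exp_minus_factor:
  assumes "x \<in> topspace X"
  shows "exp_minus (minus_log (\<phi> x)) = \<phi> x"
proof (rule exp_minus_minus_log)
  interpret prob_space "\<eta> x" using assms by (rule \<eta>_prob)
  have "\<phi> x \<le> (\<integral>\<^sup>+y. 1 \<partial>\<eta> x)"
    unfolding \<phi> [OF assms] by (intro nn_integral_mono exp_minus_le_1)
  then show "\<phi> x \<le> 1" by (simp add: emeasure_space_1)
qed

lemma config_prod_factor:
  "\<gamma> \<in> configs X \<Longrightarrow> config_prod \<gamma> \<phi> = exp_minus (\<integral>\<^sup>+x. minus_log (\<phi> x) \<partial>\<gamma>)"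
  by (rule config_prod_exp_minus [OF t1 _ measurable_minus_log_factor exp_minus_factor])

lemma measurable_config_prod: "(\<lambda>\<gamma>. config_prod \<gamma> \<phi>) \<in> borel_measurable (config_space X)"
proof -
  have "(\<lambda>\<gamma>. exp_minus (\<integral>\<^sup>+x. minus_log (\<phi> x) \<partial>\<gamma>)) \<in> borel_measurable (config_space X)"
    by (intro measurable_compose [OF _ measurable_exp_minus] measurable_nn_integral_config
        measurable_minus_log_factor)
  then show ?thesis
    by (subst measurable_cong) (auto simp: config_prod_factor)
qed

text \<open>The exponent splits over the indices and the marks are independent. Copies of a multiple
  point are separate indices with marks of equal law, so each factor occurs with its
  multiplicity.\<close>

lemma Laplace_marked_config:
  assumes "\<gamma> \<in> configs X"
  shows "(\<integral>\<^sup>+y. exp_minus (\<integral>\<^sup>+z. g z \<partial>marked_config X \<gamma> y) \<partial>cluster_product \<eta> \<gamma>) = config_prod \<gamma> \<phi>"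
proof -
  have "(\<integral>\<^sup>+y. exp_minus (\<integral>\<^sup>+z. g z \<partial>marked_config X \<gamma> y) \<partial>cluster_product \<eta> \<gamma>) =
      (\<integral>\<^sup>+y. exp_minus (\<integral>\<^sup>+i. g (fst i, y i) \<partial>count_space (config_index \<gamma>)) \<partial>cluster_product \<eta> \<gamma>)"
    by (intro nn_integral_cong) (simp add: nn_integral_marked_config [OF assms _ g])
  also have "\<dots> = exp_minus (\<integral>\<^sup>+i. minus_log (\<phi> (fst i)) \<partial>count_space (config_index \<gamma>))"
    unfolding cluster_product_eq
  proof (rule nn_integral_PiM_exp_minus)
    fix i assume "i \<in> config_index \<gamma>"
    then have x: "fst i \<in> topspace X" by (rule fst_config_index [OF assms])
    show "prob_space (\<eta> (fst i))" using x by (rule \<eta>_prob)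
    show "(\<lambda>y. g (fst i, y)) \<in> borel_measurable (\<eta> (fst i))" using x g by (rule measurable_section)
    show "exp_minus (minus_log (\<phi> (fst i))) = (\<integral>\<^sup>+y. exp_minus (g (fst i, y)) \<partial>\<eta> (fst i))"
      using x by (simp add: exp_minus_factor flip: \<phi>)
  qed (rule countable_config_index [OF assms])
  also have "\<dots> = config_prod \<gamma> \<phi>"
    unfolding config_prod_factor [OF assms]
    by (subst nn_integral_config_index [OF t1 assms measurable_minus_log_factor]) (rule refl)
  finally show ?thesis .
qed

end

text \<open>The conditional law of the marked configuration given \<open>\<gamma>\<close>, moved to
  a space that does not depend on \<open>\<gamma>\<close>; only then can it be a kernel.\<close>

definition mark_kernel :: "'a measure \<Rightarrow> ('a \<times> 'a cluster) measure measure"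
  where "mark_kernel \<gamma> = distr (cluster_product \<eta> \<gamma>) (config_space Z) (marked_config X \<gamma>)"

lemma nn_integral_mark_kernel:
  assumes "\<gamma> \<in> configs X" "F \<in> borel_measurable (config_space Z)"
  shows "(\<integral>\<^sup>+\<zeta>. F \<zeta> \<partial>mark_kernel \<gamma>) = (\<integral>\<^sup>+y. F (marked_config X \<gamma> y) \<partial>cluster_product \<eta> \<gamma>)"
  unfolding mark_kernel_def by (rule nn_integral_distr) (simp_all add: measurable_marked_config assms)

lemma sets_mark_kernel: "sets (mark_kernel \<gamma>) = sets (config_space Z)"
  by (simp add: mark_kernel_def)

lemma prob_space_mark_kernel: "\<gamma> \<in> configs X \<Longrightarrow> prob_space (mark_kernel \<gamma>)"
  unfolding mark_kernel_def
  by (intro prob_space.prob_space_distr prob_space_cluster_product measurable_marked_config)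

lemma measurable_mark_kernel:
  "mark_kernel \<in> measurable (config_space X) (subprob_algebra (config_space Z))"
proof (rule Laplace_kernel_measurable)
  fix f :: "'a \<times> 'a cluster \<Rightarrow> real"
  assume "f \<in> borel_measurable (borel_of Z)"
  then have f: "(\<lambda>z. ennreal (f z)) \<in> borel_measurable (borel_of Z)" by simp
  have eq: "(\<integral>\<^sup>+\<zeta>. exp_minus (config_pairing f \<zeta>) \<partial>mark_kernel \<gamma>) =
      config_prod \<gamma> (\<lambda>x. \<integral>\<^sup>+y. exp_minus (ennreal (f (x, y))) \<partial>\<eta> x)" if "\<gamma> \<in> configs X" for \<gamma>
  proof -
    have "(\<lambda>\<zeta>. exp_minus (config_pairing f \<zeta>)) \<in> borel_measurable (config_space Z)"
      unfolding config_pairing_def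
      by (intro measurable_compose [OF _ measurable_exp_minus] measurable_nn_integral_config f)
    then show ?thesis
      using Laplace_marked_config [OF f refl that]
      by (simp add: nn_integral_mark_kernel [OF that] config_pairing_def)
  qed
  show "(\<lambda>\<gamma>. \<integral>\<^sup>+\<zeta>. exp_minus (config_pairing f \<zeta>) \<partial>mark_kernel \<gamma>) \<in> borel_measurable (config_space X)"
    by (rule measurable_cong [THEN iffD2, OF _ measurable_config_prod [OF f refl]]) (simp add: eq)
qed (simp_all add: prob_space_mark_kernel sets_mark_kernel)

section \<open>Mixing over the law of the configuration\<close>

context
  fixes \<mu> :: "'a measure measure"
  assumes \<mu>: "prob_space \<mu>" "sets \<mu> = sets (config_space X)"
begin

lemma space_\<mu>: "space \<mu> = configs X"
  using sets_eq_imp_space_eq [OF \<mu>(2)] by simp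

lemma is_skew_measure_bind: "is_skew_measure X \<eta> \<mu> (\<mu> \<bind> mark_kernel)"
proof -
  interpret prob_space \<mu> by (rule \<mu>)
  have K: "mark_kernel \<in> measurable \<mu> (subprob_algebra (config_space Z))"
    using measurable_mark_kernel by (simp add: measurable_cong_sets [OF \<mu>(2) refl])
  show ?thesis
    unfolding is_skew_measure_def
  proof (intro conjI allI impI)
    show "prob_space (\<mu> \<bind> mark_kernel)"
      using K by (intro prob_space_bind AE_I2 prob_space_mark_kernel) (auto simp: space_\<mu>)
    show "sets (\<mu> \<bind> mark_kernel) = sets (config_space Z)"
      using K not_empty by (rule sets_bind_measurable)
    fix F :: "('a \<times> 'a cluster) measure \<Rightarrow> ennreal"
    assume F: "F \<in> borel_measurable (config_space Z)"
    show "(\<integral>\<^sup>+\<zeta>. F \<zeta> \<partial>(\<mu> \<bind> mark_kernel)) =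
        (\<integral>\<^sup>+\<gamma>. (\<integral>\<^sup>+y. F (marked_config X \<gamma> y) \<partial>cluster_product \<eta> \<gamma>) \<partial>\<mu>)"
      unfolding nn_integral_bind [OF F K]
      by (intro nn_integral_cong) (simp add: nn_integral_mark_kernel [OF _ F] space_\<mu>)
  qed
qed

text \<open>The defining property covers all measurable F with values in [0, \<infinity>], so
  indicators settle uniqueness directly, without Laplace functionals.\<close>

lemma is_skew_measure_skew_measure: "is_skew_measure X \<eta> \<mu> (skew_measure X \<eta> \<mu>)"
  unfolding skew_measure_def
proof (rule theI)
  show "is_skew_measure X \<eta> \<mu> (\<mu> \<bind> mark_kernel)" by (rule is_skew_measure_bind)
  fix \<nu> assume \<nu>: "is_skew_measure X \<eta> \<mu> \<nu>"
  show "\<nu> = \<mu> \<bind> mark_kernel"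
  proof (rule measure_eqI)
    show sets: "sets \<nu> = sets (\<mu> \<bind> mark_kernel)"
      using is_skew_measureD(2) [OF \<nu>] is_skew_measureD(2) [OF is_skew_measure_bind] by simp
    fix A assume A: "A \<in> sets \<nu>"
    then have ind: "(indicator A :: _ \<Rightarrow> ennreal) \<in> borel_measurable (config_space Z)"
      by (simp add: is_skew_measureD(2) [OF \<nu>])
    have "(\<integral>\<^sup>+\<zeta>. indicator A \<zeta> \<partial>\<nu>) = (\<integral>\<^sup>+\<zeta>. indicator A \<zeta> \<partial>(\<mu> \<bind> mark_kernel))"
      unfolding is_skew_measureD(3) [OF \<nu> ind] is_skew_measureD(3) [OF is_skew_measure_bind ind] ..
    then show "emeasure \<nu> A = emeasure (\<mu> \<bind> mark_kernel) A"
      using A sets by simp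
  qed
qed

lemma is_cluster_measure_distr:
  "is_cluster_measure X \<eta> \<mu> (distr (skew_measure X \<eta> \<mu>) (config_space X) (cluster_union X))"
proof -
  let ?S = "skew_measure X \<eta> \<mu>"
  note S = is_skew_measureD(1,2) [OF is_skew_measure_skew_measure]
    and int = is_skew_measureD(3) [OF is_skew_measure_skew_measure]
  have q: "cluster_union X \<in> measurable ?S (config_space X)"
    using measurable_cluster_union by (simp add: measurable_cong_sets [OF S(2) refl])
  show ?thesis
    unfolding is_cluster_measure_def
  proof (intro conjI ballI impI)
    show "prob_space (distr ?S (config_space X) (cluster_union X))"
      using S(1) q by (rule prob_space.prob_space_distr)
    fix f :: "'a \<Rightarrow> real" assume "f \<in> borel_measurable (borel_of X)"
    then have f: "(\<lambda>x. ennreal (f x)) \<in> borel_measurable (borel_of X)" by simp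
    \<comment> \<open>The test function seen through \<open>cluster_union\<close>: the total of f
      over the cluster, ignoring the point x to which it is attached.\<close>
    define g where "g z = (\<integral>\<^sup>+x. ennreal (f x) \<partial>cluster_config X (snd z))" for z :: "'a \<times> 'a cluster"
    have g: "g \<in> borel_measurable (borel_of Z)"
      unfolding g_def by (rule measurable_nn_integral_skew [OF f])
    have factor: "(\<integral>\<^sup>+y. exp_minus (\<Sum>\<^sub>\<infinity>i\<in>cluster_ix y. ennreal (f (snd y i))) \<partial>\<eta> x) =
        (\<integral>\<^sup>+y. exp_minus (g (x, y)) \<partial>\<eta> x)" if x: "x \<in> topspace X" for x
      using sets_eq_imp_space_eq [OF \<eta>_sets [OF x]]
      by (intro nn_integral_cong)
        (simp add: g_def infsum_eq_nn_integral_count_space nn_integral_cluster_config f)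
    have L: "(\<lambda>\<gamma>. exp_minus (config_pairing f \<gamma>)) \<in> borel_measurable (config_space X)"
      unfolding config_pairing_def
      by (intro measurable_compose [OF _ measurable_exp_minus] measurable_nn_integral_config f)
    have "(\<integral>\<^sup>+\<gamma>. exp_minus (config_pairing f \<gamma>) \<partial>distr ?S (config_space X) (cluster_union X)) =
        (\<integral>\<^sup>+\<zeta>. exp_minus (config_pairing f (cluster_union X \<zeta>)) \<partial>?S)"
      by (rule nn_integral_distr) (simp_all add: q L)
    also have "\<dots> = (\<integral>\<^sup>+\<gamma>. (\<integral>\<^sup>+y. exp_minus (config_pairing f (cluster_union X (marked_config X \<gamma> y)))
        \<partial>cluster_product \<eta> \<gamma>) \<partial>\<mu>)"
      by (intro int measurable_compose [OF measurable_cluster_union L])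
    also have "\<dots> = (\<integral>\<^sup>+\<gamma>. (\<integral>\<^sup>+y. exp_minus (\<integral>\<^sup>+z. g z \<partial>marked_config X \<gamma> y) \<partial>cluster_product \<eta> \<gamma>) \<partial>\<mu>)"
      by (intro nn_integral_cong arg_cong [where f = exp_minus])
        (simp add: config_pairing_def g_def nn_integral_cluster_union marked_config_in_configs space_\<mu> f)
    also have "\<dots> = (\<integral>\<^sup>+\<gamma>. config_prod \<gamma>
        (\<lambda>x. \<integral>\<^sup>+y. exp_minus (\<Sum>\<^sub>\<infinity>i\<in>cluster_ix y. ennreal (f (snd y i))) \<partial>\<eta> x) \<partial>\<mu>)"
      by (intro nn_integral_cong Laplace_marked_config [OF g factor]) (simp_all add: space_\<mu>)
    finally show "(\<integral>\<^sup>+\<gamma>. exp_minus (config_pairing f \<gamma>) \<partial>distr ?S (config_space X) (cluster_union X)) =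
        (\<integral>\<^sup>+\<gamma>. config_prod \<gamma>
          (\<lambda>x. \<integral>\<^sup>+y. exp_minus (\<Sum>\<^sub>\<infinity>i\<in>cluster_ix y. ennreal (f (snd y i))) \<partial>\<eta> x) \<partial>\<mu>)" .
  qed simp
qed

text \<open>Here only the Laplace functional is prescribed, so uniqueness rests on
  \<open>Laplace_unique\<close>; existence is the preceding lemma.\<close>

lemma cluster_measure_eq_distr:
  "cluster_measure X \<eta> \<mu> = distr (skew_measure X \<eta> \<mu>) (config_space X) (cluster_union X)"
  unfolding cluster_measure_def
proof (rule the_equality, rule is_cluster_measure_distr)
  fix \<nu> assume \<nu>: "is_cluster_measure X \<eta> \<mu> \<nu>"
  let ?D = "distr (skew_measure X \<eta> \<mu>) (config_space X) (cluster_union X)"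
  show "\<nu> = ?D"
  proof (rule Laplace_unique [where S = X])
    show "prob_space \<nu>" "sets \<nu> = sets (config_space X)"
      using \<nu> by (rule is_cluster_measureD)+
    show "prob_space ?D" "sets ?D = sets (config_space X)"
      using is_cluster_measure_distr by (rule is_cluster_measureD)+
    fix f :: "'a \<Rightarrow> real"
    assume "f \<in> borel_measurable (borel_of X)" "\<And>x. x \<in> topspace X \<Longrightarrow> 0 \<le> f x"
    then have f: "f \<in> borel_measurable (borel_of X)" "\<forall>x\<in>topspace X. 0 \<le> f x" by auto
    show "(\<integral>\<^sup>+\<gamma>. exp_minus (config_pairing f \<gamma>) \<partial>\<nu>) = (\<integral>\<^sup>+\<gamma>. exp_minus (config_pairing f \<gamma>) \<partial>?D)"
      unfolding is_cluster_measureD(3) [OF \<nu> f] is_cluster_measureD(3) [OF is_cluster_measure_distr f] ..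
  qed
qed

end

end

theorem theorem3p2:
  fixes X :: "'a topology"
    and \<mu> :: "'a measure measure"
    and \<eta> :: "'a \<Rightarrow> 'a cluster measure"
  assumes polish: "completely_metrizable_space X" "separable_space X"
    and \<mu>: "prob_space \<mu>" "sets \<mu> = sets (config_space X)"
    and \<eta>_prob: "\<And>x. x \<in> topspace X \<Longrightarrow> prob_space (\<eta> x)"
    and \<eta>_sets: "\<And>x. x \<in> topspace X \<Longrightarrow> sets (\<eta> x) = sets (borel_of (cluster_topology X))"
    and \<eta>_measurable: "\<And>B. B \<in> sets (borel_of (cluster_topology X)) \<Longrightarrow>
      (\<lambda>x. emeasure (\<eta> x) B) \<in> borel_measurable (borel_of X)"
  shows "cluster_measure X \<eta> \<mu> =
    distr (skew_measure X \<eta> \<mu>) (config_space X) (cluster_union X)"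
proof -
  interpret cluster_field X \<eta>
  proof (rule cluster_field.intro)
    show "t1_space X"
      using polish(1) by (intro metrizable_imp_t1_space completely_metrizable_imp_metrizable_space)
    show "second_countable X"
      using polish by (rule completely_metrizable_separable_imp_second_countable)
  qed (rule \<eta>_prob \<eta>_sets \<eta>_measurable, assumption)+
  show ?thesis using \<mu> by (rule cluster_measure_eq_distr)
qed

end
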